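(* For all $f\in L^2(\mathbb{R}^2)$, $$\mathcal{H}(f)\le\frac{\pi}{8}\|f\|_{L^2(\mathbb{R}^2)}^4,$$ and the constant $\frac{\pi}{8}$ is optimal. Moreover, for fixed $M>0$, a function $f$ with $\|f\|_{L^2}=M$ satisfies $\mathcal{H}(f)=\frac{\pi}{8}M^4$ if and only if $f$ equals, up to the symmetries of $\mathcal{H}$, the Gaussian $M\,G$ with $G(x)=\frac{1}{\sqrt\pi}e^{-|x|^2/2}$.
   Context: The Hamiltonian is $$\mathcal{H}(f)=\frac14\int_{-1}^1\int_{\mathbb{R}^2}\int_{\mathbb{R}^2}f(\xi+z)\,f(\xi+\lambda z^\perp)\,\overline{f(\xi+z+\lambda z^\perp)}\,\overline{f(\xi)}\,dz\,d\xi\,d\lambda,\qquad f\in L^2(\mathbb{R}^2),$$ where $z^\perp$ is the rotation of $z\in\mathbb{R}^2$ by $+\pi/2$. "Up to the symmetries of $\mathcal{H}$" means up to finitely many compositions of the following transformations, which preserve both $\mathcal{H}$ and the $L^2$ norm: phase rotation $f\mapsto e^{i\theta}f$; translation $f\mapsto f(\cdot+x_0)$, $x_0\in\mathbb{R}^2$; modulation $f\mapsto e^{ix\cdot\xi_0}f$, $\xi_0\in\mathbb{R}^2$; quadratic modulation $f\mapsto e^{i\tau|x|^2}f$, $\tau\in\mathbb{R}$; Schrödinger group $f\mapsto e^{i\tau\Delta}f$, $\tau\in\mathbb{R}$; rotation $f\mapsto f(R_\theta\cdot)$; scaling $f\mapsto\mu f(\mu\,\cdot)$, $\mu>0$; Fourier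 transform $f\mapsto\widehat f$, $\widehat f(\xi)=\frac1{2\pi}\int_{\mathbb{R}^2}e^{-ix\cdot\xi}f(x)dx$. *)

theory Defs
  imports "HOL-Analysis.Analysis"
begin

(* Elements of L^2 are handled through their Borel representatives. *)
definition L2 :: "(real^2 \<Rightarrow> complex) set" where
  "L2 = {f. f \<in> borel_measurable lborel \<and> integrable lborel (\<lambda>x. (cmod (f x))\<^sup>2)}"

definition L2_norm :: "(real^2 \<Rightarrow> complex) \<Rightarrow> real" where
  "L2_norm f = sqrt (LINT x|lborel. (cmod (f x))\<^sup>2)"

definition rot :: "real \<Rightarrow> real^2 \<Rightarrow> real^2" where
  "rot \<theta> x = vector [cos \<theta> * x$1 - sin \<theta> * x$2, sin \<theta> * x$1 + cos \<theta> * x$2]"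

definition perp :: "real^2 \<Rightarrow> real^2" where
  "perp z = vector [- z$2, z$1]"

definition hamiltonian_integrand ::
    "(real^2 \<Rightarrow> complex) \<Rightarrow> real \<Rightarrow> real^2 \<Rightarrow> real^2 \<Rightarrow> complex" where
  "hamiltonian_integrand f l \<xi> z =
     f (\<xi> + z) * f (\<xi> + l *\<^sub>R perp z) * cnj (f (\<xi> + z + l *\<^sub>R perp z)) * cnj (f \<xi>)"

(* The Bochner integral is 0 by convention where it does not converge, so convergence of
   the defining integral of the Hamiltonian is a separate predicate. The values are a priori
   complex. *)
definition hamiltonian_converges :: "(real^2 \<Rightarrow> complex) \<Rightarrow> bool" where
  "hamiltonian_converges f \<longleftrightarrow>
     set_integrable lborel ({-1..1} \<times> UNIV) (\<lambda>(l, \<xi>, z). hamiltonian_integrand f l \<xi> z)"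

definition hamiltonian :: "(real^2 \<Rightarrow> complex) \<Rightarrow> complex" where
  "hamiltonian f =
     1/4 * (LINT l:{-1..1}|lborel. LINT \<xi>|lborel. LINT z|lborel. hamiltonian_integrand f l \<xi> z)"

definition truncated_fourier ::
    "real \<Rightarrow> real \<Rightarrow> (real^2 \<Rightarrow> complex) \<Rightarrow> real^2 \<Rightarrow> complex" where
  "truncated_fourier s R f \<xi> =
     complex_of_real (1 / (2 * pi)) * (LINT x:cball 0 R|lborel. cis (s * (x \<bullet> \<xi>)) * f x)"

(* The Fourier transform on L^2 is the L^2 limit of truncated Fourier integrals. It is
   determined only almost everywhere, hence a relation: g is a version of the transform
   of f. The nonnegative integral rules out spurious convergence from undefined norms. *)
definition is_fourier_sgn ::
    "real \<Rightarrow> (real^2 \<Rightarrow> complex) \<Rightarrow> (real^2 \<Rightarrow> complex) \<Rightarrow> bool" where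
  "is_fourier_sgn s f g \<longleftrightarrow> f \<in> L2 \<and> g \<in> L2 \<and>
     ((\<lambda>R. \<integral>\<^sup>+\<xi>. ennreal ((cmod (truncated_fourier s R f \<xi> - g \<xi>))\<^sup>2) \<partial>lborel)
        \<longlongrightarrow> 0) at_top"

abbreviation is_fourier :: "(real^2 \<Rightarrow> complex) \<Rightarrow> (real^2 \<Rightarrow> complex) \<Rightarrow> bool" where
  "is_fourier \<equiv> is_fourier_sgn (-1)"

abbreviation is_inverse_fourier :: "(real^2 \<Rightarrow> complex) \<Rightarrow> (real^2 \<Rightarrow> complex) \<Rightarrow> bool" where
  "is_inverse_fourier \<equiv> is_fourier_sgn 1"

(* On L^2 the Schroedinger group is the Fourier multiplier exp (-i tau |xi|^2). *)
inductive symmetry_step :: "(real^2 \<Rightarrow> complex) \<Rightarrow> (real^2 \<Rightarrow> complex) \<Rightarrow> bool" where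
  phase_rotation: "symmetry_step f (\<lambda>x. cis \<theta> * f x)"
| translation: "symmetry_step f (\<lambda>x. f (x + x0))"
| modulation: "symmetry_step f (\<lambda>x. cis (x \<bullet> \<xi>0) * f x)"
| quadratic_modulation: "symmetry_step f (\<lambda>x. cis (\<tau> * (norm x)\<^sup>2) * f x)"
| schroedinger_group:
    "is_fourier f h \<Longrightarrow> is_inverse_fourier (\<lambda>\<xi>. cis (- \<tau> * (norm \<xi>)\<^sup>2) * h \<xi>) g
       \<Longrightarrow> symmetry_step f g"
| rotation: "symmetry_step f (\<lambda>x. f (rot \<theta> x))"
| scaling: "\<mu> > 0 \<Longrightarrow> symmetry_step f (\<lambda>x. complex_of_real \<mu> * f (\<mu> *\<^sub>R x))"
| fourier_transform: "is_fourier f g \<Longrightarrow> symmetry_step f g"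

definition equal_up_to_symmetries ::
    "(real^2 \<Rightarrow> complex) \<Rightarrow> (real^2 \<Rightarrow> complex) \<Rightarrow> bool" where
  "equal_up_to_symmetries f g \<longleftrightarrow>
     (\<exists>h. symmetry_step\<^sup>*\<^sup>* g h \<and> (AE x in lborel. f x = h x))"

definition gaussian :: "real^2 \<Rightarrow> complex" where
  "gaussian x = complex_of_real (1 / sqrt pi * exp (- (norm x)\<^sup>2 / 2))"

end

theory Submission
  imports Defs "HOL-Probability.Distributions" "HOL-Complex_Analysis.Cauchy_Integral_Theorem"
    "HOL-Real_Asymp.Real_Asymp"
begin

text \<open>
  A triple \<open>(\<lambda>, \<xi>, z)\<close> describes a rectangle with consecutive vertices \<open>\<xi>\<close>, \<open>\<xi> + z\<close>,
  \<open>\<xi> + z + \<lambda> z\<^sup>\<bottom>\<close>, \<open>\<xi> + \<lambda> z\<^sup>\<bottom>\<close>, and the integrand of the Hamiltonian is \<open>D1 * cnj D2\<close>, where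
  \<open>D1\<close> and \<open>D2\<close> are the products of \<open>f\<close> over the end points of the two diagonals. For fixed
  \<open>\<lambda>\<close>, each of the two maps from \<open>(\<xi>, z)\<close> to the end points of a diagonal is linear with
  determinant \<open>1 + \<lambda>\<^sup>2\<close>. Hence \<open>|D1|\<^sup>2\<close> and \<open>|D2|\<^sup>2\<close> both have integral
  \<open>\<parallel>f\<parallel>\<^sup>4 * (arctan 1 - arctan (-1)) = (\<pi>/2) \<parallel>f\<parallel>\<^sup>4\<close>, and expanding \<open>|D1 - D2|\<^sup>2\<close> gives the
  identity \<open>8 Re H(f) = \<pi> \<parallel>f\<parallel>\<^sup>4 - \<integral>|D1 - D2|\<^sup>2\<close> (\<open>hamiltonian_deficit\<close>). It contains the
  inequality, and it shows that equality holds exactly if \<open>D1 = D2\<close> almost everywhere, that is,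
  \<open>f(\<xi> + z) f(\<xi> + \<lambda> z\<^sup>\<bottom>) = f(\<xi> + z + \<lambda> z\<^sup>\<bottom>) f(\<xi>)\<close> on almost every rectangle.

  This functional equation determines \<open>f\<close>. Multiply it, for one suitable \<open>\<lambda>\<close>, by a test function
  at the vertex \<open>\<xi> + z + \<lambda> z\<^sup>\<bottom>\<close> and integrate over \<open>z\<close>: the right side becomes a nonzero constant
  times \<open>f(\<xi>)\<close>, while the left side is continuous in \<open>\<xi>\<close>. So \<open>f\<close> has a continuous version
  (\<open>continuous_representative\<close>), and by continuity that version satisfies the equation on every
  rectangle. It has no zeros, because a zero closest to a point where \<open>f\<close> does not vanish would
  produce a rectangle violating the equation (\<open>rectangle_multiplicative_nonzero\<close>). Its continuous
  logarithm is therefore additive over rectangles and must be a quadratic polynomial with a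
  multiple of \<open>|x|\<^sup>2\<close> as leading part (\<open>rectangle_additive_quadratic\<close>). Square integrability makes
  \<open>f\<close> a Gaussian with complex parameters, and scaling, translation, modulation, quadratic
  modulation and phase rotation reach every such function from the multiple of the standard
  Gaussian that has the same norm (\<open>gaussian_type_in_orbit\<close>).

  Conversely, complex Gaussians satisfy the functional equation because the squared distances
  of opposite vertices of a rectangle from the origin have the same sum for both diagonals
  (\<open>gaussian_type_extremal\<close>). Every symmetry maps this class to itself; the only analytic point is the Fourier transform
  (\<open>gaussian_type_fourier\<close>), which is computed by shifting the contour of a Gaussian integral.
\<close>


section \<open>Conformal linear maps of the plane\<close>

lemma perp_nth [simp]: "perp z $ 1 = - z $ 2" "perp z $ 2 = z $ 1"
  by (simp_all add: perp_def)

lemma linear_perp: "linear perp"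
  by (rule linearI) (simp_all add: vec_eq_iff forall_2)

lemma continuous_on_perp [continuous_intros]:
  "continuous_on S f \<Longrightarrow> continuous_on S (\<lambda>x. perp (f x))"
  by (rule bounded_linear.continuous_on[OF linear_perp[unfolded linear_conv_bounded_linear]])

lemma perp_measurable [measurable]: "perp \<in> borel_measurable borel"
  by (intro borel_measurable_continuous_onI continuous_intros)

text \<open>The plane is identified with the complex numbers: this is multiplication by \<open>a + \<i> b\<close>. Scalings,
  rotations and the maps \<open>z \<mapsto> \<plusminus> z + \<lambda> z\<^sup>\<bottom>\<close> all have this form.\<close>
definition conformal :: "real \<Rightarrow> real \<Rightarrow> real^2 \<Rightarrow> real^2" where
  "conformal a b z = a *\<^sub>R z + b *\<^sub>R perp z"

lemma conformal_nth [simp]: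
  "conformal a b z $ 1 = a * z $ 1 - b * z $ 2" "conformal a b z $ 2 = a * z $ 2 + b * z $ 1"
  by (simp_all add: conformal_def)

lemma linear_conformal: "linear (conformal a b)"
  by (rule linearI) (simp_all add: vec_eq_iff forall_2 algebra_simps)

lemma conformal_measurable [measurable]: "conformal a b \<in> borel_measurable borel"
  unfolding conformal_def by measurable

lemma det_conformal: "det (matrix (conformal a b)) = a\<^sup>2 + b\<^sup>2"
  by (simp add: det_2 matrix_def axis_def power2_eq_square)

lemma conformal_inverse:
  assumes "a\<^sup>2 + b\<^sup>2 \<noteq> 0"
  shows "conformal a b (conformal (a / (a\<^sup>2 + b\<^sup>2)) (- b / (a\<^sup>2 + b\<^sup>2)) z) = z"
proof -
  have "conformal a b (conformal c d z) = conformal (a * c - b * d) (a * d + b * c) z" for c d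
    by (simp add: vec_eq_iff forall_2 algebra_simps)
  moreover have "a * (a / D) - b * (- b / D) = (a\<^sup>2 + b\<^sup>2) / D" "a * (- b / D) + b * (a / D) = 0" for D
    by (simp_all add: power2_eq_square add_divide_distrib)
  moreover have "conformal 1 0 z = z" by (simp add: vec_eq_iff forall_2)
  ultimately show ?thesis
    by (simp only: divide_self[OF assms])
qed

lemma vimage_conformal:
  assumes "a\<^sup>2 + b\<^sup>2 \<noteq> 0"
  shows "conformal a b -` S = conformal (a / (a\<^sup>2 + b\<^sup>2)) (- b / (a\<^sup>2 + b\<^sup>2)) ` S"
proof -
  define A where "A = a / (a\<^sup>2 + b\<^sup>2)"
  define B where "B = - b / (a\<^sup>2 + b\<^sup>2)"
  have AB: "A\<^sup>2 + B\<^sup>2 = 1 / (a\<^sup>2 + b\<^sup>2)"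
    using assms by (simp add: A_def B_def power_divide add_divide_distrib[symmetric]) (simp add: power2_eq_square)
  have "A\<^sup>2 + B\<^sup>2 \<noteq> 0" using AB assms by simp
  moreover have "A / (A\<^sup>2 + B\<^sup>2) = a" "- B / (A\<^sup>2 + B\<^sup>2) = b"
    unfolding AB using assms by (auto simp: A_def B_def)
  ultimately have "conformal A B (conformal a b z) = z" for z
    using conformal_inverse[of A B z] by simp
  then have 1: "x = conformal A B (conformal a b x)" for x by simp
  have 2: "conformal a b (conformal A B z) = z" for z
    using conformal_inverse[OF assms] by (simp add: A_def B_def)
  have "conformal a b -` S = conformal A B ` S"
  proof (intro set_eqI iffI)
    fix x assume "x \<in> conformal a b -` S"
    then show "x \<in> conformal A B ` S" by (intro image_eqI[where x = "conformal a b x"] 1) simp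
  qed (auto simp: 2 simp del: conformal_nth)
  then show ?thesis by (simp add: A_def B_def)
qed

text \<open>It suffices to compare the measures on boxes. There the formula for the volume of a linear image
  applies, and the determinant of the map is the squared modulus \<open>a\<^sup>2 + b\<^sup>2\<close>.\<close>
lemma distr_conformal:
  assumes "a\<^sup>2 + b\<^sup>2 \<noteq> 0"
  shows "distr lborel borel (conformal a b) = density lborel (\<lambda>_. ennreal (1 / (a\<^sup>2 + b\<^sup>2)))"
proof -
  define D where "D = a\<^sup>2 + b\<^sup>2"
  have D: "D > 0" using assms by (auto simp: D_def add_nonneg_eq_0_iff less_le)
  have "lborel = density (distr lborel borel (conformal a b)) (\<lambda>_. ennreal D)"
  proof (rule lborel_eqI)
    fix l u :: "real^2" assume lu: "\<And>b. b \<in> Basis \<Longrightarrow> l \<bullet> b \<le> u \<bullet> b"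
    have lm: "box l u \<in> lmeasurable" by simp
    have vi: "conformal a b -` box l u = conformal (a / D) (- b / D) ` box l u"
      using vimage_conformal[OF assms] by (simp add: D_def)
    have dt: "\<bar>det (matrix (conformal (a / D) (- b / D)))\<bar> = 1 / D"
      using D by (simp add: det_conformal power_divide add_divide_distrib[symmetric] D_def[symmetric])
        (simp add: power2_eq_square)
    have fin: "conformal (a / D) (- b / D) ` box l u \<in> lmeasurable"
      using measurable_linear_image[OF linear_conformal lm] .
    have bo: "conformal a b -` box l u \<in> sets borel"
      using measurable_sets[OF conformal_measurable, of "box l u" a b] by simp
    have "emeasure lborel (conformal a b -` box l u) = emeasure lebesgue (conformal a b -` box l u)"
      using bo by simp
    also have "\<dots> = ennreal (measure lebesgue (conformal a b -` box l u))"
      using fin vi emeasure_eq_measure2 by (metis)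
    also have "\<dots> = ennreal (1 / D * measure lebesgue (box l u))"
      using measure_linear_image[OF linear_conformal lm] dt vi by metis
    finally have "emeasure lborel (conformal a b -` box l u) = ennreal (1 / D * measure lborel (box l u))"
      by (simp add: measure_completion)
    moreover have "emeasure (density (distr lborel borel (conformal a b)) (\<lambda>_. ennreal D)) (box l u) =
        ennreal D * emeasure lborel (conformal a b -` box l u)"
      by (subst emeasure_density) (simp_all add: nn_integral_cmult emeasure_distr)
    ultimately show "emeasure (density (distr lborel borel (conformal a b)) (\<lambda>_. ennreal D)) (box l u) = 
        ennreal (\<Prod>b\<in>Basis. (u - l) \<bullet> b)"
    proof -
      assume "emeasure lborel (conformal a b -` box l u) = ennreal (1 / D * measure lborel (box l u))"
        and "emeasure (density (distr lborel borel (conformal a b)) (\<lambda>_. ennreal D)) (box l u) =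
        ennreal D * emeasure lborel (conformal a b -` box l u)"
      moreover have "ennreal D * ennreal (1 / D * m) = ennreal m" for m
        using D by (simp add: ennreal_mult'[symmetric])
      ultimately show ?thesis using lu by (simp add: measure_lborel_box)
    qed
  qed simp
  then have "density lborel (\<lambda>_. ennreal (1 / D)) =
      density (density (distr lborel borel (conformal a b)) (\<lambda>_. ennreal D)) (\<lambda>_. ennreal (1 / D))" by metis
  also have "\<dots> = distr lborel borel (conformal a b)"
    using D by (simp add: density_density_eq ennreal_mult[symmetric] density_1)
  finally show ?thesis by (simp add: D_def)
qed

lemma nn_integral_conformal:
  assumes "a\<^sup>2 + b\<^sup>2 \<noteq> 0" "g \<in> borel_measurable borel"
  shows "(\<integral>\<^sup>+z. g (x0 + conformal a b z) \<partial>lborel) = ennreal (1 / (a\<^sup>2 + b\<^sup>2)) * (\<integral>\<^sup>+z. g z \<partial>lborel)"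
proof -
  note [measurable] = assms(2)
  have "(\<integral>\<^sup>+z. g (x0 + conformal a b z) \<partial>lborel) = (\<integral>\<^sup>+z. g (x0 + z) \<partial>distr lborel borel (conformal a b))"
    by (simp add: nn_integral_distr)
  also have "\<dots> = ennreal (1 / (a\<^sup>2 + b\<^sup>2)) * (\<integral>\<^sup>+z. g (x0 + z) \<partial>lborel)"
    by (subst distr_conformal[OF assms(1)]) (simp add: nn_integral_density nn_integral_cmult)
  also have "(\<integral>\<^sup>+z. g (x0 + z) \<partial>lborel) = (\<integral>\<^sup>+z. g z \<partial>distr lborel borel ((+) x0))"
    by (simp add: nn_integral_distr)
  finally show ?thesis by (simp add: lborel_distr_plus)
qed

lemma AE_lborel_conformal:
  assumes "a\<^sup>2 + b\<^sup>2 \<noteq> 0" "AE x in lborel. P x"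
  shows "AE z in lborel. P (x0 + conformal a b z)"
proof -
  obtain N where N: "N \<in> sets borel" "emeasure lborel N = 0" "{x. \<not> P x} \<subseteq> N"
    using assms(2) by (auto elim!: AE_E)
  have "(\<integral>\<^sup>+z. indicator N (x0 + conformal a b z) \<partial>lborel) = 0"
    using N(1,2) by (subst nn_integral_conformal[OF assms(1)]) auto
  moreover have "(\<lambda>z. indicator N (x0 + conformal a b z) :: ennreal) \<in> borel_measurable lborel"
    using N(1) by measurable
  ultimately have "AE z in lborel. (indicator N (x0 + conformal a b z) :: ennreal) = 0"
    using nn_integral_0_iff_AE by blast
  then show ?thesis
    by eventually_elim (use N(3) in \<open>auto simp: indicator_def split: if_splits\<close>)
qed

lemma integral_conformal:
  fixes g :: "real^2 \<Rightarrow> 'b::{banach, second_countable_topology}"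
  assumes "a\<^sup>2 + b\<^sup>2 \<noteq> 0" and [measurable]: "g \<in> borel_measurable borel"
  shows "(LINT z|lborel. g (x0 + conformal a b z)) = (1 / (a\<^sup>2 + b\<^sup>2)) *\<^sub>R (LINT z|lborel. g z)"
proof -
  have "(LINT z|lborel. g (x0 + conformal a b z)) = (LINT z|distr lborel borel (conformal a b). g (x0 + z))"
    by (simp add: integral_distr)
  also have "\<dots> = (1 / (a\<^sup>2 + b\<^sup>2)) *\<^sub>R (LINT z|lborel. g (x0 + z))"
    by (subst distr_conformal[OF assms(1)]) (simp add: integral_density)
  also have "(LINT z|lborel. g (x0 + z)) = (LINT z|distr lborel borel ((+) x0). g z)"
    by (simp add: integral_distr)
  finally show ?thesis by (simp add: lborel_distr_plus)
qed


section \<open>The deficit identity\<close>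

text \<open>The triple \<open>(l, \<xi>, z)\<close> stands for the rectangle with consecutive vertices \<open>\<xi>\<close>, \<open>\<xi> + z\<close>,
  \<open>\<xi> + z + l z\<^sup>\<bottom>\<close>, \<open>\<xi> + l z\<^sup>\<bottom>\<close>. The integrand of the Hamiltonian is the product of \<open>f\<close> over
  one diagonal times the conjugate of the product over the other.\<close>
definition diagonal1 :: "(real^2 \<Rightarrow> complex) \<Rightarrow> real \<times> (real^2) \<times> (real^2) \<Rightarrow> complex" where
  "diagonal1 f = (\<lambda>(l, \<xi>, z). f (\<xi> + z) * f (\<xi> + l *\<^sub>R perp z))"

definition diagonal2 :: "(real^2 \<Rightarrow> complex) \<Rightarrow> real \<times> (real^2) \<times> (real^2) \<Rightarrow> complex" where
  "diagonal2 f = (\<lambda>(l, \<xi>, z). f (\<xi> + z + l *\<^sub>R perp z) * f \<xi>)"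

abbreviation rectangles :: "(real \<times> (real^2) \<times> (real^2)) set" where
  "rectangles \<equiv> {-1..1} \<times> UNIV"

lemma diagonal_measurable [measurable]:
  assumes [measurable]: "f \<in> borel_measurable borel"
  shows "diagonal1 f \<in> borel_measurable borel" "diagonal2 f \<in> borel_measurable borel"
  unfolding diagonal1_def diagonal2_def borel_prod[symmetric] by measurable

lemma cnj_measurable [measurable]: "cnj \<in> borel_measurable borel"
  by (intro borel_measurable_continuous_onI continuous_intros)

lemma rectangles_borel [measurable]: "rectangles \<in> sets borel"
  by (simp add: borel_closed closed_Times)

lemma hamiltonian_integrand_eq:
  "(\<lambda>(l, \<xi>, z). hamiltonian_integrand f l \<xi> z) = (\<lambda>p. diagonal1 f p * cnj (diagonal2 f p))"
  by (auto simp: hamiltonian_integrand_def diagonal1_def diagonal2_def fun_eq_iff)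

lemma nn_integral_diagonal2_slice:
  fixes \<phi> :: "real^2 \<Rightarrow> ennreal"
  assumes [measurable]: "\<phi> \<in> borel_measurable borel"
  shows "(\<integral>\<^sup>+\<xi>. \<integral>\<^sup>+z. \<phi> (\<xi> + z + l *\<^sub>R perp z) * \<phi> \<xi> \<partial>lborel \<partial>lborel) = 
     ennreal (1 / (1 + l\<^sup>2)) * (\<integral>\<^sup>+x. \<phi> x \<partial>lborel)\<^sup>2"
proof -
  have nz: "1\<^sup>2 + l\<^sup>2 \<noteq> 0" by (simp add: add_nonneg_eq_0_iff)
  have "(\<integral>\<^sup>+z. \<phi> (\<xi> + z + l *\<^sub>R perp z) * \<phi> \<xi> \<partial>lborel) = 
      (\<integral>\<^sup>+z. \<phi> (\<xi> + conformal 1 l z) \<partial>lborel) * \<phi> \<xi>" for \<xi>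
    by (simp add: nn_integral_multc conformal_def add.assoc)
  also have "\<dots> \<xi> = ennreal (1 / (1 + l\<^sup>2)) * (\<integral>\<^sup>+x. \<phi> x \<partial>lborel) * \<phi> \<xi>" for \<xi>
    using nn_integral_conformal[OF nz, of \<phi>] by simp
  finally show ?thesis by (simp add: nn_integral_cmult power2_eq_square mult.assoc)
qed

text \<open>Translating \<open>\<xi>\<close> by \<open>- z\<close> turns the end points of the diagonal into \<open>\<xi>\<close> and \<open>\<xi> - z + l z\<^sup>\<bottom>\<close>,
  and \<open>z \<mapsto> - z + l z\<^sup>\<bottom>\<close> is conformal with determinant \<open>1 + l\<^sup>2\<close>.\<close>
lemma nn_integral_diagonal1_slice:
  fixes \<phi> :: "real^2 \<Rightarrow> ennreal"
  assumes [measurable]: "\<phi> \<in> borel_measurable borel"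
  shows "(\<integral>\<^sup>+\<xi>. \<integral>\<^sup>+z. \<phi> (\<xi> + z) * \<phi> (\<xi> + l *\<^sub>R perp z) \<partial>lborel \<partial>lborel) = 
     ennreal (1 / (1 + l\<^sup>2)) * (\<integral>\<^sup>+x. \<phi> x \<partial>lborel)\<^sup>2"
proof -
  have nz: "(-1)\<^sup>2 + l\<^sup>2 \<noteq> 0" by (simp add: add_nonneg_eq_0_iff)
  have "(\<integral>\<^sup>+\<xi>. \<integral>\<^sup>+z. \<phi> (\<xi> + z) * \<phi> (\<xi> + l *\<^sub>R perp z) \<partial>lborel \<partial>lborel) =
    (\<integral>\<^sup>+z. \<integral>\<^sup>+\<xi>. \<phi> (\<xi> + z) * \<phi> (\<xi> + l *\<^sub>R perp z) \<partial>lborel \<partial>lborel)"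
    by (rule lborel_pair.Fubini') measurable
  also have "\<dots> = (\<integral>\<^sup>+z. \<integral>\<^sup>+\<xi>. \<phi> \<xi> * \<phi> (\<xi> + conformal (-1) l z) \<partial>lborel \<partial>lborel)"
  proof (rule nn_integral_cong)
    fix z
    have "(\<integral>\<^sup>+\<xi>. \<phi> (\<xi> + z) * \<phi> (\<xi> + l *\<^sub>R perp z) \<partial>lborel) = 
      (\<integral>\<^sup>+\<xi>. \<phi> (z + \<xi>) * \<phi> ((z + \<xi>) + conformal (-1) l z) \<partial>lborel)"
      by (intro nn_integral_cong) (simp add: conformal_def algebra_simps)
    also have "\<dots> = (\<integral>\<^sup>+\<xi>. \<phi> \<xi> * \<phi> (\<xi> + conformal (-1) l z) \<partial>distr lborel borel ((+) z))"
      by (subst nn_integral_distr) auto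
    finally show "(\<integral>\<^sup>+\<xi>. \<phi> (\<xi> + z) * \<phi> (\<xi> + l *\<^sub>R perp z) \<partial>lborel) = 
      (\<integral>\<^sup>+\<xi>. \<phi> \<xi> * \<phi> (\<xi> + conformal (-1) l z) \<partial>lborel)"
      by (simp add: lborel_distr_plus)
  qed
  also have "\<dots> = (\<integral>\<^sup>+\<xi>. \<integral>\<^sup>+z. \<phi> \<xi> * \<phi> (\<xi> + conformal (-1) l z) \<partial>lborel \<partial>lborel)"
    by (rule lborel_pair.Fubini') (unfold conformal_def, measurable)
  also have "\<dots> = (\<integral>\<^sup>+\<xi>. \<phi> \<xi> * (\<integral>\<^sup>+z. \<phi> (\<xi> + conformal (-1) l z) \<partial>lborel) \<partial>lborel)"
    by (simp add: nn_integral_cmult)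
  also have "\<dots> = (\<integral>\<^sup>+\<xi>. \<phi> \<xi> * (ennreal (1 / (1 + l\<^sup>2)) * (\<integral>\<^sup>+x. \<phi> x \<partial>lborel)) \<partial>lborel)"
    by (subst nn_integral_conformal[OF nz]) simp_all
  finally show ?thesis by (simp add: nn_integral_multc power2_eq_square mult_ac)
qed

lemma nn_integral_arctan:
  "(\<integral>\<^sup>+l. indicator {-1..1} l * ennreal (1 / (1 + l\<^sup>2)) \<partial>lborel) = ennreal (pi / 2)"
proof -
  have "(\<integral>\<^sup>+l. ennreal (1 / (1 + l\<^sup>2)) * indicator {-1..1} l \<partial>lborel) = ennreal (arctan 1 - arctan (-1))"
    by (rule nn_integral_FTC_Icc)
      (auto intro!: derivative_eq_intros simp: divide_inverse has_real_derivative_iff_has_vector_derivative[symmetric])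
  then show ?thesis by (simp add: arctan_one arctan_minus mult.commute)
qed

lemma nn_integral_rectangles:
  fixes g :: "real \<times> (real^2) \<times> (real^2) \<Rightarrow> ennreal"
  assumes [measurable]: "g \<in> borel_measurable borel"
    and slice: "\<And>l. (\<integral>\<^sup>+\<xi>. \<integral>\<^sup>+z. g (l, \<xi>, z) \<partial>lborel \<partial>lborel) = ennreal (1 / (1 + l\<^sup>2)) * c"
  shows "(\<integral>\<^sup>+p. indicator rectangles p * g p \<partial>lborel) = ennreal (pi / 2) * c"
proof -
  have [measurable]: "g \<in> borel_measurable (borel \<Otimes>\<^sub>M borel \<Otimes>\<^sub>M borel)"
    using assms(1) by (simp add: borel_prod)
  have [measurable]: "rectangles \<in> sets (borel \<Otimes>\<^sub>M borel \<Otimes>\<^sub>M borel)"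
    by (simp only: borel_prod rectangles_borel)
  have "(\<integral>\<^sup>+p. indicator rectangles p * g p \<partial>lborel) =
      (\<integral>\<^sup>+l. \<integral>\<^sup>+q. indicator {-1..1} l * g (l, q) \<partial>lborel \<partial>lborel)"
    unfolding lborel_prod[symmetric]
    by (subst lborel_pair.nn_integral_fst[symmetric]) (auto simp: indicator_def intro!: nn_integral_cong)
  also have "\<dots> = (\<integral>\<^sup>+l. indicator {-1..1} l * (\<integral>\<^sup>+q. g (l, q) \<partial>(lborel \<Otimes>\<^sub>M lborel)) \<partial>lborel)"
    by (simp add: nn_integral_cmult lborel_prod)
  also have "\<dots> = (\<integral>\<^sup>+l. indicator {-1..1} l * (\<integral>\<^sup>+\<xi>. \<integral>\<^sup>+z. g (l, \<xi>, z) \<partial>lborel \<partial>lborel) \<partial>lborel)"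
    by (subst lborel.nn_integral_fst[symmetric]) auto
  also have "\<dots> = (\<integral>\<^sup>+l. indicator {-1..1} l * ennreal (1 / (1 + l\<^sup>2)) * c \<partial>lborel)"
    by (simp add: slice mult.assoc)
  also have "\<dots> = ennreal (pi / 2) * c"
    by (subst nn_integral_multc) (simp_all add: nn_integral_arctan)
  finally show ?thesis .
qed

lemma L2_measurable: "f \<in> L2 \<Longrightarrow> f \<in> borel_measurable borel"
  by (simp add: L2_def)

lemma L2_nn_integral:
  assumes "f \<in> L2"
  shows "(\<integral>\<^sup>+x. ennreal ((cmod (f x))\<^sup>2) \<partial>lborel) = ennreal ((L2_norm f)\<^sup>2)"
  using assms by (subst nn_integral_eq_integral) (auto simp: L2_def L2_norm_def)

lemma L2_norm_nonneg [simp]: "0 \<le> L2_norm f"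
  by (simp add: L2_norm_def)

lemma L2_iff_nn_integral:
  assumes "f \<in> borel_measurable borel"
  shows "f \<in> L2 \<longleftrightarrow> (\<integral>\<^sup>+x. ennreal ((cmod (f x))\<^sup>2) \<partial>lborel) < \<infinity>"
  using assms by (auto simp: L2_def integrable_iff_bounded)

lemma nn_integral_diagonals:
  assumes "f \<in> L2"
  shows "(\<integral>\<^sup>+p. indicator rectangles p * ennreal ((cmod (diagonal1 f p))\<^sup>2) \<partial>lborel) = ennreal (pi / 2 * L2_norm f ^ 4)"
    and "(\<integral>\<^sup>+p. indicator rectangles p * ennreal ((cmod (diagonal2 f p))\<^sup>2) \<partial>lborel) = ennreal (pi / 2 * L2_norm f ^ 4)"
proof -
  note [measurable] = L2_measurable[OF assms]
  let ?\<phi> = "\<lambda>x. ennreal ((cmod (f x))\<^sup>2)"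
  have N: "(\<integral>\<^sup>+x. ?\<phi> x \<partial>lborel)\<^sup>2 = ennreal (L2_norm f ^ 4)"
    by (simp add: L2_nn_integral assms ennreal_power flip: power_mult)
  have "(\<integral>\<^sup>+\<xi>. \<integral>\<^sup>+z. ennreal ((cmod (diagonal1 f (l, \<xi>, z)))\<^sup>2) \<partial>lborel \<partial>lborel) = ennreal (1 / (1 + l\<^sup>2)) * ennreal (L2_norm f ^ 4)" for l
    using nn_integral_diagonal1_slice[of ?\<phi> l]
    by (simp add: N diagonal1_def norm_mult power_mult_distrib ennreal_mult'')
  then show "(\<integral>\<^sup>+p. indicator rectangles p * ennreal ((cmod (diagonal1 f p))\<^sup>2) \<partial>lborel) = ennreal (pi / 2 * L2_norm f ^ 4)"
    by (subst nn_integral_rectangles[where c = "ennreal (L2_norm f ^ 4)"]) (auto simp: ennreal_mult''[symmetric])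
  have "(\<integral>\<^sup>+\<xi>. \<integral>\<^sup>+z. ennreal ((cmod (diagonal2 f (l, \<xi>, z)))\<^sup>2) \<partial>lborel \<partial>lborel) = ennreal (1 / (1 + l\<^sup>2)) * ennreal (L2_norm f ^ 4)" for l
    using nn_integral_diagonal2_slice[of ?\<phi> l]
    by (simp add: N diagonal2_def norm_mult power_mult_distrib ennreal_mult'')
  then show "(\<integral>\<^sup>+p. indicator rectangles p * ennreal ((cmod (diagonal2 f p))\<^sup>2) \<partial>lborel) = ennreal (pi / 2 * L2_norm f ^ 4)"
    by (subst nn_integral_rectangles[where c = "ennreal (L2_norm f ^ 4)"]) (auto simp: ennreal_mult''[symmetric])
qed

lemma integral_diagonals:
  assumes "f \<in> L2"
  shows "has_bochner_integral lborel (\<lambda>p. indicator rectangles p * (cmod (diagonal1 f p))\<^sup>2) (pi / 2 * L2_norm f ^ 4)"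
    and "has_bochner_integral lborel (\<lambda>p. indicator rectangles p * (cmod (diagonal2 f p))\<^sup>2) (pi / 2 * L2_norm f ^ 4)"
proof -
  note [measurable] = L2_measurable[OF assms]
  have *: "ennreal (indicator rectangles p * r) = indicator rectangles p * ennreal r" for p r
    by (simp add: indicator_def)
  show "has_bochner_integral lborel (\<lambda>p. indicator rectangles p * (cmod (diagonal1 f p))\<^sup>2) (pi / 2 * L2_norm f ^ 4)"
    by (rule has_bochner_integral_nn_integral) (use nn_integral_diagonals[OF assms] in \<open>auto simp: *\<close>)
  show "has_bochner_integral lborel (\<lambda>p. indicator rectangles p * (cmod (diagonal2 f p))\<^sup>2) (pi / 2 * L2_norm f ^ 4)"
    by (rule has_bochner_integral_nn_integral) (use nn_integral_diagonals[OF assms] in \<open>auto simp: *\<close>)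
qed

theorem hamiltonian_converges_L2:
  assumes "f \<in> L2"
  shows "hamiltonian_converges f"
  unfolding hamiltonian_converges_def hamiltonian_integrand_eq set_integrable_def
proof (rule Bochner_Integration.integrable_bound)
  note [measurable] = L2_measurable[OF assms]
  show "integrable lborel (\<lambda>p. indicator rectangles p * (cmod (diagonal1 f p))\<^sup>2 + indicator rectangles p * (cmod (diagonal2 f p))\<^sup>2)"
    using integral_diagonals[OF assms] by (intro Bochner_Integration.integrable_add) (auto simp: has_bochner_integral_iff)
  show "(\<lambda>p. indicat_real rectangles p *\<^sub>R (diagonal1 f p * cnj (diagonal2 f p))) \<in> borel_measurable lborel"
    by measurable
  have "norm (x * cnj y) \<le> (cmod x)\<^sup>2 + (cmod y)\<^sup>2" for x y :: complex
    using sum_squares_bound[of "cmod x" "cmod y"] mult_nonneg_nonneg[OF norm_ge_zero norm_ge_zero, of x y]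
    unfolding norm_mult complex_mod_cnj by linarith
  then show "AE p in lborel. norm (indicat_real rectangles p *\<^sub>R (diagonal1 f p * cnj (diagonal2 f p)))
      \<le> norm (indicator rectangles p * (cmod (diagonal1 f p))\<^sup>2 + indicator rectangles p * (cmod (diagonal2 f p))\<^sup>2)"
    by (auto simp: indicator_def)
qed

text \<open>Fubini's theorem. On a null set of \<open>l\<close> the slices may fail to be integrable; there the iterated
  integral takes its default value.\<close>
lemma hamiltonian_eq_joint_integral:
  assumes "f \<in> L2"
  shows "hamiltonian f = 1/4 * (LINT p:rectangles|lborel. diagonal1 f p * cnj (diagonal2 f p))"
proof -
  note [measurable] = L2_measurable[OF assms]
  let ?I = "\<lambda>p. diagonal1 f p * cnj (diagonal2 f p)"
  have int: "integrable (lborel \<Otimes>\<^sub>M (lborel \<Otimes>\<^sub>M lborel)) (\<lambda>p. indicat_real rectangles p *\<^sub>R ?I p)"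
    using hamiltonian_converges_L2[OF assms]
    unfolding hamiltonian_converges_def hamiltonian_integrand_eq set_integrable_def
    by (simp add: lborel_prod)
  have I: "?I (l, \<xi>, z) = hamiltonian_integrand f l \<xi> z" for l \<xi> z
    using hamiltonian_integrand_eq[of f] by (auto simp: fun_eq_iff)
  have "?I \<in> borel_measurable borel" by measurable
  then have [measurable]: "?I \<in> borel_measurable (borel \<Otimes>\<^sub>M borel \<Otimes>\<^sub>M borel)"
    by (simp add: borel_prod)
  have "(LINT p:rectangles|lborel. ?I p) = (LINT p|(lborel \<Otimes>\<^sub>M (lborel \<Otimes>\<^sub>M lborel)). indicat_real rectangles p *\<^sub>R ?I p)"
    by (simp add: set_lebesgue_integral_def lborel_prod)
  also have "\<dots> = (LINT l|lborel. LINT q|(lborel \<Otimes>\<^sub>M lborel). indicat_real rectangles (l, q) *\<^sub>R ?I (l, q))"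
    using lborel_pair.integral_fst'[OF int[unfolded lborel_prod[where 'a = "real^2"]]]
    by (simp only: lborel_prod)
  also have "\<dots> = (LINT l|lborel. indicat_real {-1..1} l *\<^sub>R (LINT \<xi>|lborel. LINT z|lborel. hamiltonian_integrand f l \<xi> z))"
  proof (rule integral_cong_AE)
    show "(\<lambda>l. LINT q|(lborel \<Otimes>\<^sub>M lborel). indicat_real rectangles (l, q) *\<^sub>R ?I (l, q)) \<in> borel_measurable lborel"
      using lborel_pair.integrable_fst'[OF int[unfolded lborel_prod[where 'a = "real^2"]]]
      by (simp only: lborel_prod borel_measurable_integrable)
    show "(\<lambda>l. indicat_real {-1..1} l *\<^sub>R (LINT \<xi>|lborel. LINT z|lborel. hamiltonian_integrand f l \<xi> z)) \<in> borel_measurable lborel"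
      unfolding I[symmetric] by measurable
    have "AE l in lborel. integrable (lborel \<Otimes>\<^sub>M lborel) (\<lambda>q. indicat_real rectangles (l, q) *\<^sub>R ?I (l, q))"
      using lborel_pair.AE_integrable_fst'[OF int[unfolded lborel_prod[where 'a = "real^2"]]]
      by (simp only: lborel_prod)
    then show "AE l in lborel. (LINT q|(lborel \<Otimes>\<^sub>M lborel). indicat_real rectangles (l, q) *\<^sub>R ?I (l, q)) =
       indicat_real {-1..1} l *\<^sub>R (LINT \<xi>|lborel. LINT z|lborel. hamiltonian_integrand f l \<xi> z)"
    proof eventually_elim
      case (elim l)
      from lborel_pair.integral_fst'[OF elim] show ?case
        unfolding I[symmetric] by (auto simp: indicator_def)
    qed
  qed
  finally show ?thesis
    by (simp add: hamiltonian_def set_lebesgue_integral_def)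
qed

text \<open>Expand \<open>|D1 - D2|\<^sup>2 = |D1|\<^sup>2 + |D2|\<^sup>2 - 2 Re (D1 * cnj D2)\<close> for the two diagonal products and
  integrate over all rectangles. Unlike the Cauchy--Schwarz inequality for the mixed term, the
  identity keeps track of the case of equality.\<close>
theorem hamiltonian_deficit:
  assumes "f \<in> L2"
  shows "has_bochner_integral lborel (\<lambda>p. indicator rectangles p * (cmod (diagonal1 f p - diagonal2 f p))\<^sup>2)
           (pi * L2_norm f ^ 4 - 8 * Re (hamiltonian f))"
proof -
  note [measurable] = L2_measurable[OF assms]
  let ?I = "\<lambda>p. indicat_real rectangles p *\<^sub>R (diagonal1 f p * cnj (diagonal2 f p))"
  have "integrable lborel ?I"
    using hamiltonian_converges_L2[OF assms]
    unfolding hamiltonian_converges_def hamiltonian_integrand_eq set_integrable_def .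
  moreover have "integral\<^sup>L lborel ?I = 4 * hamiltonian f"
    unfolding hamiltonian_eq_joint_integral[OF assms] set_lebesgue_integral_def by simp
  ultimately have "has_bochner_integral lborel ?I (4 * hamiltonian f)"
    by (simp only: has_bochner_integral_iff simp_thms)
  then have "has_bochner_integral lborel (\<lambda>p. Re (?I p)) (4 * Re (hamiltonian f))"
    using has_bochner_integral_bounded_linear[OF bounded_linear_Re] by force
  from has_bochner_integral_diff[OF has_bochner_integral_add[OF integral_diagonals[OF assms]] has_bochner_integral_mult_right[where c = 2, OF this]]
  have "has_bochner_integral lborel (\<lambda>p. indicator rectangles p * (cmod (diagonal1 f p))\<^sup>2 + indicator rectangles p * (cmod (diagonal2 f p))\<^sup>2 - 2 * Re (?I p))
     (pi * L2_norm f ^ 4 - 8 * Re (hamiltonian f))" by simp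
  moreover have "indicator rectangles p * (cmod (diagonal1 f p))\<^sup>2 + indicator rectangles p * (cmod (diagonal2 f p))\<^sup>2 - 2 * Re (?I p) =
      indicator rectangles p * (cmod (diagonal1 f p - diagonal2 f p))\<^sup>2" for p
    by (cases "p \<in> rectangles") (simp_all add: cmod_power2, simp add: power2_eq_square algebra_simps)
  ultimately show ?thesis by simp
qed

corollary hamiltonian_le:
  assumes "f \<in> L2"
  shows "Re (hamiltonian f) \<le> pi / 8 * L2_norm f ^ 4"
proof -
  have "0 \<le> pi * L2_norm f ^ 4 - 8 * Re (hamiltonian f)"
    unfolding has_bochner_integral_integral_eq[OF hamiltonian_deficit[OF assms], symmetric]
    by (rule Bochner_Integration.integral_nonneg) simp
  then show ?thesis by simp
qed

corollary hamiltonian_eq_iff: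
  assumes "f \<in> L2"
  shows "Re (hamiltonian f) = pi / 8 * L2_norm f ^ 4 \<longleftrightarrow>
    (AE p in lborel. p \<in> rectangles \<longrightarrow> diagonal1 f p = diagonal2 f p)"
proof -
  note [measurable] = L2_measurable[OF assms]
  let ?D = "\<lambda>p. indicator rectangles p * (cmod (diagonal1 f p - diagonal2 f p))\<^sup>2"
  have "Re (hamiltonian f) = pi / 8 * L2_norm f ^ 4 \<longleftrightarrow> integral\<^sup>L lborel ?D = 0"
    using hamiltonian_deficit[OF assms] by (auto simp: has_bochner_integral_iff)
  also have "\<dots> \<longleftrightarrow> (AE p in lborel. ?D p = 0)"
    using hamiltonian_deficit[OF assms]
    by (intro integral_nonneg_eq_0_iff_AE) (auto simp: has_bochner_integral_iff indicator_def)
  also have "\<dots> \<longleftrightarrow> (AE p in lborel. p \<in> rectangles \<longrightarrow> diagonal1 f p = diagonal2 f p)"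
    by (intro AE_cong) (auto simp: indicator_def)
  finally show ?thesis .
qed

text \<open>The same rectangle seen from its vertex \<open>\<xi> + z\<close>: the side \<open>z\<close> is reversed, and the sign of \<open>l\<close>
  changes so that the other side \<open>l z\<^sup>\<bottom>\<close> stays the same.\<close>
definition swap_diagonals :: "real \<times> (real^2) \<times> (real^2) \<Rightarrow> real \<times> (real^2) \<times> (real^2)" where
  "swap_diagonals = (\<lambda>(l, \<xi>, z). (- l, \<xi> + z, - z))"

lemma diagonal_swap:
  "diagonal1 f (swap_diagonals p) = diagonal2 f p" "diagonal2 f (swap_diagonals p) = diagonal1 f p"
proof -
  have "perp (- z) = - perp z" for z
    by (simp add: vec_eq_iff forall_2)
  then show "diagonal1 f (swap_diagonals p) = diagonal2 f p" "diagonal2 f (swap_diagonals p) = diagonal1 f p"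
    by (auto simp: swap_diagonals_def diagonal1_def diagonal2_def split_beta algebra_simps)
qed

lemma swap_diagonals_measurable [measurable]: "swap_diagonals \<in> borel_measurable borel"
  unfolding swap_diagonals_def borel_prod[symmetric] by measurable

lemma distr_swap_diagonals: "distr lborel borel swap_diagonals = lborel"
proof (rule measure_eqI)
  fix A :: "(real \<times> (real^2) \<times> (real^2)) set"
  assume "A \<in> sets (distr lborel borel swap_diagonals)"
  then have A: "A \<in> sets borel" by simp
  then have [measurable]: "A \<in> sets (borel \<Otimes>\<^sub>M borel \<Otimes>\<^sub>M borel)" by (metis borel_prod)
  define g :: "real \<times> (real^2) \<times> (real^2) \<Rightarrow> ennreal" where "g = indicator A"
  have [measurable]: "g \<in> borel_measurable (borel \<Otimes>\<^sub>M borel \<Otimes>\<^sub>M borel)"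
    unfolding g_def by measurable
  have [measurable]: "swap_diagonals \<in> borel \<Otimes>\<^sub>M borel \<Otimes>\<^sub>M borel \<rightarrow>\<^sub>M borel \<Otimes>\<^sub>M borel \<Otimes>\<^sub>M borel"
    by (simp add: borel_prod)
  have refl_real: "(\<integral>\<^sup>+x. h (- x) \<partial>lborel) = (\<integral>\<^sup>+x. h x \<partial>lborel)" if "h \<in> borel_measurable borel" for h :: "real \<Rightarrow> ennreal"
    using that by (subst lborel_distr_uminus[symmetric]) (simp add: nn_integral_distr)
  have refl_plane: "(\<integral>\<^sup>+z. h (- z) \<partial>lborel) = (\<integral>\<^sup>+z. h z \<partial>lborel)" if "h \<in> borel_measurable borel" for h :: "real^2 \<Rightarrow> ennreal"
    using nn_integral_conformal[of "-1" 0 h 0] that by (simp add: conformal_def)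
  have trans_plane: "(\<integral>\<^sup>+x. h (x + z) \<partial>lborel) = (\<integral>\<^sup>+x. h x \<partial>lborel)" if "h \<in> borel_measurable borel" for h :: "real^2 \<Rightarrow> ennreal" and z
    using nn_integral_conformal[of 1 0 h z] that by (simp add: conformal_def add.commute)
  have triple: "(\<integral>\<^sup>+p. h p \<partial>lborel) = (\<integral>\<^sup>+l. \<integral>\<^sup>+\<xi>. \<integral>\<^sup>+z. h (l, \<xi>, z) \<partial>lborel \<partial>lborel \<partial>lborel)"
    if [measurable]: "h \<in> borel_measurable (borel \<Otimes>\<^sub>M borel \<Otimes>\<^sub>M borel)"
    for h :: "real \<times> (real^2) \<times> (real^2) \<Rightarrow> ennreal"
  proof -
    have [measurable]: "h \<in> borel_measurable borel" using that by (simp add: borel_prod)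
    have "(\<integral>\<^sup>+l. \<integral>\<^sup>+q. h (l, q) \<partial>lborel \<partial>lborel) = (\<integral>\<^sup>+p. h p \<partial>lborel)"
      using lborel.nn_integral_fst[of h lborel] by (simp add: lborel_prod)
    moreover have "(\<integral>\<^sup>+\<xi>. \<integral>\<^sup>+z. h (l, \<xi>, z) \<partial>lborel \<partial>lborel) = (\<integral>\<^sup>+q. h (l, q) \<partial>lborel)" for l
      using lborel.nn_integral_fst[of "\<lambda>q. h (l, q)" lborel] by (simp add: lborel_prod)
    ultimately show ?thesis by simp
  qed
  have "emeasure (distr lborel borel swap_diagonals) A = (\<integral>\<^sup>+p. g p \<partial>distr lborel borel swap_diagonals)"
    using A by (simp add: g_def)
  also have "\<dots> = (\<integral>\<^sup>+p. g (swap_diagonals p) \<partial>lborel)"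
    using A by (subst nn_integral_distr) (simp_all add: g_def)
  also have "\<dots> = (\<integral>\<^sup>+l. \<integral>\<^sup>+\<xi>. \<integral>\<^sup>+z. g (- l, \<xi> + z, - z) \<partial>lborel \<partial>lborel \<partial>lborel)"
    by (subst triple) (simp_all add: swap_diagonals_def)
  also have "\<dots> = (\<integral>\<^sup>+l. \<integral>\<^sup>+z. \<integral>\<^sup>+\<xi>. g (- l, \<xi> + z, - z) \<partial>lborel \<partial>lborel \<partial>lborel)"
    by (intro nn_integral_cong lborel_pair.Fubini') measurable
  also have "\<dots> = (\<integral>\<^sup>+l. \<integral>\<^sup>+z. \<integral>\<^sup>+\<xi>. g (- l, \<xi>, - z) \<partial>lborel \<partial>lborel \<partial>lborel)"
    by (simp add: trans_plane[where h = "\<lambda>\<xi>. g (_, \<xi>, _)"])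
  also have "\<dots> = (\<integral>\<^sup>+l. \<integral>\<^sup>+z. \<integral>\<^sup>+\<xi>. g (l, \<xi>, z) \<partial>lborel \<partial>lborel \<partial>lborel)"
    by (simp add: refl_plane[where h = "\<lambda>z. \<integral>\<^sup>+\<xi>. g (_, \<xi>, z) \<partial>lborel"]
        refl_real[where h = "\<lambda>l. \<integral>\<^sup>+z. \<integral>\<^sup>+\<xi>. g (l, \<xi>, z) \<partial>lborel \<partial>lborel"])
  also have "\<dots> = (\<integral>\<^sup>+l. \<integral>\<^sup>+\<xi>. \<integral>\<^sup>+z. g (l, \<xi>, z) \<partial>lborel \<partial>lborel \<partial>lborel)"
    by (intro nn_integral_cong lborel_pair.Fubini') measurable
  also have "\<dots> = emeasure lborel A"
    using A by (subst triple[symmetric]) (simp_all add: g_def)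
  finally show "emeasure (distr lborel borel swap_diagonals) A = emeasure lborel A" .
qed simp

text \<open>Exchanging the diagonals conjugates the integrand and preserves the measure and the domain.\<close>
theorem hamiltonian_real:
  assumes "f \<in> L2"
  shows "hamiltonian f \<in> \<real>"
proof -
  note [measurable] = L2_measurable[OF assms]
  let ?I = "\<lambda>p. diagonal1 f p * cnj (diagonal2 f p)"
  have "(LINT p:rectangles|lborel. ?I p) = (LINT p|distr lborel borel swap_diagonals. indicat_real rectangles p *\<^sub>R ?I p)"
    by (simp add: set_lebesgue_integral_def distr_swap_diagonals)
  also have "\<dots> = (LINT p|lborel. indicat_real rectangles (swap_diagonals p) *\<^sub>R ?I (swap_diagonals p))"
    by (subst integral_distr) auto
  also have "\<dots> = (LINT p|lborel. cnj (indicat_real rectangles p *\<^sub>R ?I p))"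
    by (intro Bochner_Integration.integral_cong refl)
      (auto simp: diagonal_swap, auto simp: swap_diagonals_def indicator_def split_beta)
  also have "\<dots> = cnj (LINT p:rectangles|lborel. ?I p)"
    unfolding set_lebesgue_integral_def by (rule Bochner_Integration.integral_cnj)
  finally show ?thesis
    unfolding hamiltonian_eq_joint_integral[OF assms] by (simp add: complex_is_Real_iff complex_eq_iff)
qed


section \<open>Approximation in L2 and continuity of rectangle integrals\<close>

text \<open>A retraction onto the disc of radius \<open>K\<close>, written as multiplication by a factor in \<open>[0, 1]\<close>:
  together with the cutoff it only shrinks \<open>w\<close>, so that the truncation error is at most \<open>norm w\<close>.\<close>
definition clip :: "real \<Rightarrow> complex \<Rightarrow> complex" where
  "clip K w = of_real (K / max K (norm w)) * w"

definition cutoff :: "real \<Rightarrow> real^2 \<Rightarrow> real" where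
  "cutoff K x = max 0 (min 1 (K + 1 - norm x))"

lemma continuous_clip: "K > 0 \<Longrightarrow> continuous_on UNIV (clip K)"
  unfolding clip_def by (intro continuous_intros) (auto simp: max_def)

lemma continuous_cutoff: "continuous_on UNIV (cutoff K)"
  unfolding cutoff_def by (intro continuous_intros)

lemma norm_clip_le: "K > 0 \<Longrightarrow> norm (clip K w) \<le> K"
  by (auto simp: clip_def norm_mult norm_divide max_def field_simps)

lemma cutoff_bounds: "0 \<le> cutoff K x" "cutoff K x \<le> 1"
  by (auto simp: cutoff_def)

lemma truncation_error_le:
  assumes "K > 0"
  shows "norm (w - of_real (cutoff K x) * clip K w) \<le> norm w"
proof -
  define c where "c = cutoff K x * (K / max K (norm w))"
  have "0 \<le> K / max K (norm w)" "K / max K (norm w) \<le> 1"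
    using assms by (auto simp: divide_le_eq_1 max_def)
  then have "0 \<le> c" "c \<le> 1"
    unfolding c_def using cutoff_bounds[of K x] by (intro mult_nonneg_nonneg mult_le_one; simp)+
  have "w - of_real (cutoff K x) * clip K w = of_real (1 - c) * w"
    by (simp add: clip_def c_def algebra_simps)
  then show ?thesis
    using \<open>0 \<le> c\<close> \<open>c \<le> 1\<close> by (simp only: norm_mult norm_of_real) (auto intro!: mult_left_le_one_le)
qed

lemma truncation_eventually:
  "\<forall>\<^sub>F n in sequentially. of_real (cutoff (real n) x) * clip (real n) w = w"
proof -
  have "\<forall>\<^sub>F n in sequentially. real n > max 1 (max (norm w) (norm x))"
    using filterlim_real_sequentially unfolding filterlim_at_top_dense by blast
  then show ?thesis
  proof eventually_elim
    case (elim n)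
    then have "max (real n) (norm w) = real n" "real n > 0" "cutoff (real n) x = 1"
      by (auto simp: cutoff_def)
    then show ?case by (simp add: clip_def)
  qed
qed

lemma measurable_AE_limit_of_continuous:
  fixes f :: "'a::euclidean_space \<Rightarrow> 'b::euclidean_space"
  assumes "f \<in> borel_measurable borel"
  obtains G where "\<And>n. continuous_on UNIV (G n)" "AE x in lborel. (\<lambda>n. G n x) \<longlonglongrightarrow> f x"
proof -
  have "f \<in> borel_measurable lebesgue"
    using assms by (simp add: measurable_completion)
  then have "f measurable_on UNIV"
    by (intro lebesgue_measurable_imp_measurable_on) auto
  then obtain N G where N: "negligible N" and G: "\<And>n. continuous_on UNIV (G n)"
      "\<And>x. x \<notin> N \<Longrightarrow> (\<lambda>n. G n x) \<longlonglongrightarrow> f x"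
    unfolding measurable_on_def by auto
  have "AE x in lebesgue. x \<notin> N"
    using N unfolding negligible_iff_null_sets by (rule AE_not_in)
  then have "AE x in lborel. x \<notin> N"
    by (simp add: AE_completion_iff)
  then have "AE x in lborel. (\<lambda>n. G n x) \<longlonglongrightarrow> f x"
    by eventually_elim (rule G(2))
  with G(1) show ?thesis using that by blast
qed

definition L2sq :: "(real^2 \<Rightarrow> complex) \<Rightarrow> ennreal" where
  "L2sq f = (\<integral>\<^sup>+x. ennreal ((cmod (f x))\<^sup>2) \<partial>lborel)"

lemma L2sq_add_le:
  assumes [measurable]: "f \<in> borel_measurable borel" "g \<in> borel_measurable borel"
  shows "L2sq (\<lambda>x. f x + g x) \<le> 2 * L2sq f + 2 * L2sq g"
proof -
  have "(cmod (a + b))\<^sup>2 \<le> 2 * (cmod a)\<^sup>2 + 2 * (cmod b)\<^sup>2" for a b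
  proof -
    have "(cmod (a + b))\<^sup>2 \<le> (cmod a + cmod b)\<^sup>2"
      by (intro power_mono norm_triangle_ineq) simp
    also have "\<dots> \<le> 2 * (cmod a)\<^sup>2 + 2 * (cmod b)\<^sup>2"
      using sum_squares_bound[of "cmod a" "cmod b"] by (simp add: power2_sum)
    finally show ?thesis .
  qed
  then have "L2sq (\<lambda>x. f x + g x) \<le> (\<integral>\<^sup>+x. ennreal (2 * (cmod (f x))\<^sup>2 + 2 * (cmod (g x))\<^sup>2) \<partial>lborel)"
    unfolding L2sq_def by (intro nn_integral_mono ennreal_leI)
  also have "\<dots> = 2 * L2sq f + 2 * L2sq g"
    by (simp add: L2sq_def ennreal_mult nn_integral_add nn_integral_cmult)
  finally show ?thesis .
qed

lemma L2sq_tendsto_zero: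
  assumes [measurable]: "\<And>n. u n \<in> borel_measurable borel" "w \<in> borel_measurable borel"
    and bound: "\<And>n x. cmod (u n x) \<le> w x" and fin: "(\<integral>\<^sup>+x. ennreal ((w x)\<^sup>2) \<partial>lborel) < \<infinity>"
    and lim: "AE x in lborel. (\<lambda>n. u n x) \<longlonglongrightarrow> 0"
  shows "(\<lambda>n. L2sq (u n)) \<longlonglongrightarrow> 0"
proof -
  have "(\<lambda>n. \<integral>\<^sup>+x. ennreal ((cmod (u n x))\<^sup>2) \<partial>lborel) \<longlonglongrightarrow> (\<integral>\<^sup>+x. 0 \<partial>(lborel :: (real^2) measure))"
  proof (rule nn_integral_dominated_convergence[where w = "\<lambda>x. ennreal ((w x)\<^sup>2)"])
    show "AE x in lborel. ennreal ((cmod (u n x))\<^sup>2) \<le> ennreal ((w x)\<^sup>2)" for n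
      by (intro AE_I2 ennreal_leI power_mono bound) simp
    show "AE x in lborel. (\<lambda>n. ennreal ((cmod (u n x))\<^sup>2)) \<longlonglongrightarrow> 0"
      using lim
    proof eventually_elim
      case (elim x)
      then have "(\<lambda>n. (cmod (u n x))\<^sup>2) \<longlonglongrightarrow> 0"
        using tendsto_power[OF tendsto_norm[OF elim], of 2] by simp
      then show ?case using tendsto_ennrealI by fastforce
    qed
  qed (use fin in auto)
  then show ?thesis by (simp add: L2sq_def)
qed

text \<open>Truncate \<open>f\<close> in value and in space, which costs little by dominated convergence. Apply the same
  continuous truncation to continuous functions that converge to \<open>f\<close> almost everywhere: now the
  functions are bounded by a fixed multiple of the indicator of a ball, so they converge in L2.\<close>
lemma L2_dense_compact_support:
  assumes f: "f \<in> L2" and e: "(e::ennreal) > 0"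
  obtains g R where "continuous_on UNIV g" "\<And>x. R < norm x \<Longrightarrow> g x = 0" "bounded (range g)"
    "L2sq (\<lambda>x. f x - g x) < e"
proof -
  note [measurable] = L2_measurable[OF f]
  have fin: "L2sq f < \<infinity>"
    by (simp add: L2_nn_integral f L2sq_def)
  define f' where "f' n x = of_real (cutoff (real n) x) * clip (real n) (f x)" for n x
  have cl[measurable]: "clip K \<in> borel_measurable borel" if "K > 0" for K
    using that by (intro borel_measurable_continuous_onI continuous_clip)
  have [measurable]: "cutoff K \<in> borel_measurable borel" for K
    by (intro borel_measurable_continuous_onI continuous_cutoff)
  have f'_m: "f' (Suc n) \<in> borel_measurable borel" for n
    unfolding f'_def using cl[of "real (Suc n)"] by measurable
  have "(\<lambda>n. L2sq (\<lambda>x. f x - f' (Suc n) x)) \<longlonglongrightarrow> 0"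
  proof (rule L2sq_tendsto_zero[where w = "\<lambda>x. cmod (f x)"])
    show "cmod (f x - f' (Suc n) x) \<le> cmod (f x)" for n x
      unfolding f'_def by (rule truncation_error_le) simp
    have "(\<lambda>n. f x - f' (Suc n) x) \<longlonglongrightarrow> 0" for x
    proof (rule tendsto_eventually)
      have "\<forall>\<^sub>F n in sequentially. f x - f' n x = 0"
        using truncation_eventually[of x "f x"] by (auto simp: f'_def elim: eventually_mono)
      then show "\<forall>\<^sub>F n in sequentially. f x - f' (Suc n) x = 0"
        by (rule eventually_sequentially_Suc[THEN iffD2])
    qed
    then show "AE x in lborel. (\<lambda>n. f x - f' (Suc n) x) \<longlonglongrightarrow> 0" by simp
  qed (use f'_m fin in \<open>auto simp: L2sq_def\<close>)
  moreover have e4: "e / 4 > 0" using e by (simp add: ennreal_zero_less_divide)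
  ultimately have "\<forall>\<^sub>F n in sequentially. L2sq (\<lambda>x. f x - f' (Suc n) x) < e / 4"
    by (rule order_tendstoD)
  then obtain n where n: "L2sq (\<lambda>x. f x - f' (Suc n) x) < e / 4"
    by (auto simp: eventually_sequentially)
  define K where "K = real (Suc n)"
  have K: "K > 0" by (simp add: K_def)
  note [measurable] = cl[OF K]
  obtain G where G: "\<And>n. continuous_on UNIV (G n)" "AE x in lborel. (\<lambda>n. G n x) \<longlonglongrightarrow> f x"
    using measurable_AE_limit_of_continuous[OF L2_measurable[OF f]] by blast
  have [measurable]: "G n \<in> borel_measurable borel" for n
    by (intro borel_measurable_continuous_onI G)
  define g where "g n x = of_real (cutoff K x) * clip K (G n x)" for n x
  have g_m [measurable]: "g n \<in> borel_measurable borel" for n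
    unfolding g_def by measurable
  have "(\<lambda>m. L2sq (\<lambda>x. f' (Suc n) x - g m x)) \<longlonglongrightarrow> 0"
  proof (rule L2sq_tendsto_zero[where w = "\<lambda>x. 2 * K * indicator (cball 0 (K + 1)) x"])
    show "cmod (f' (Suc n) x - g m x) \<le> 2 * K * indicator (cball 0 (K + 1)) x" for m x
    proof -
      have "f' (Suc n) x - g m x = of_real (cutoff K x) * (clip K (f x) - clip K (G m x))"
        by (simp add: f'_def g_def K_def algebra_simps)
      moreover have "norm (clip K (f x) - clip K (G m x)) \<le> 2 * K"
        using norm_triangle_ineq4[of "clip K (f x)" "clip K (G m x)"] norm_clip_le[OF K, of "f x"]
          norm_clip_le[OF K, of "G m x"] by linarith
      moreover have "cutoff K x \<le> indicator (cball 0 (K + 1)) x"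
        by (auto simp: cutoff_def indicator_def)
      ultimately show ?thesis
        using cutoff_bounds[of K x] mult_mono[of "cutoff K x" "indicator (cball 0 (K + 1)) x"
          "norm (clip K (f x) - clip K (G m x))" "2 * K"]
        by (simp add: norm_mult mult.commute)
    qed
    have "(\<integral>\<^sup>+x. ennreal ((2 * K * indicator (cball (0::real^2) (K + 1)) x)\<^sup>2) \<partial>lborel) =
        (\<integral>\<^sup>+x. ennreal ((2 * K)\<^sup>2) * indicator (cball (0::real^2) (K + 1)) x \<partial>lborel)"
      by (intro nn_integral_cong) (auto simp: indicator_def)
    also have "\<dots> < \<infinity>"
      using emeasure_bounded_finite[OF bounded_cball, of "0::real^2" "K + 1"]
      by (subst nn_integral_cmult_indicator) (auto simp: ennreal_mult_less_top)
    finally show "(\<integral>\<^sup>+x. ennreal ((2 * K * indicator (cball (0::real^2) (K + 1)) x)\<^sup>2) \<partial>lborel) < \<infinity>" .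
    show "AE x in lborel. (\<lambda>m. f' (Suc n) x - g m x) \<longlonglongrightarrow> 0"
      using G(2)
    proof eventually_elim
      case (elim x)
      have "(\<lambda>m. clip K (G m x)) \<longlonglongrightarrow> clip K (f x)"
        using continuous_clip[OF K] elim
        by (metis UNIV_I continuous_on_eq_continuous_at isCont_tendsto_compose open_UNIV)
      then have "(\<lambda>m. g m x) \<longlonglongrightarrow> f' (Suc n) x"
        unfolding f'_def g_def K_def[symmetric] by (intro tendsto_intros)
      from tendsto_diff[OF tendsto_const[of "f' (Suc n) x"] this] show ?case by simp
    qed
    show "(\<lambda>x. 2 * K * indicat_real (cball 0 (K + 1)) x) \<in> borel_measurable borel"
      by (intro borel_measurable_times borel_measurable_const borel_measurable_indicator) simp
  qed (use f'_m in measurable)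
  from order_tendstoD(2)[OF this e4]
  obtain m where m: "L2sq (\<lambda>x. f' (Suc n) x - g m x) < e / 4"
    by (auto simp: eventually_sequentially)
  show thesis
  proof
    show "continuous_on UNIV (g m)"
      unfolding g_def
      by (intro continuous_intros continuous_cutoff continuous_on_compose2[OF continuous_clip[OF K] G(1)]) auto
    show "g m x = 0" if "K + 1 < norm x" for x
      using that by (simp add: g_def cutoff_def)
    have "norm (g m x) \<le> K" for x
    proof -
      have "cutoff K x * norm (clip K (G m x)) \<le> 1 * K"
        by (intro mult_mono cutoff_bounds norm_clip_le K) simp_all
      then show ?thesis
        using cutoff_bounds(1)[of K x] by (simp add: g_def norm_mult)
    qed
    then show "bounded (range (g m))" by (auto simp: bounded_iff)
    have "L2sq (\<lambda>x. f x - g m x) \<le> 2 * L2sq (\<lambda>x. f x - f' (Suc n) x) + 2 * L2sq (\<lambda>x. f' (Suc n) x - g m x)"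
      using L2sq_add_le[of "\<lambda>x. f x - f' (Suc n) x" "\<lambda>x. f' (Suc n) x - g m x"] f'_m by simp
    also have "\<dots> < 2 * (e / 4) + 2 * (e / 4)"
      using n m by (intro add_strict_mono ennreal_mult_strict_left_mono) auto
    also have "\<dots> = e"
    proof -
      have "e / 4 * 4 = e"
        by (simp add: ennreal_divide_times mult_divide_eq_ennreal)
      then show ?thesis by (simp add: distrib_right[symmetric] mult.commute)
    qed
    finally show "L2sq (\<lambda>x. f x - g m x) < e" .
  qed
qed


lemma AE_eq_imp_eq_closure:
  fixes h k :: "'a::euclidean_space \<Rightarrow> 'b::real_normed_vector"
  assumes "open U" "continuous_on UNIV h" "continuous_on UNIV k"
    and ae: "AE x in lborel. x \<in> U \<longrightarrow> h x = k x" and x: "x \<in> closure U"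
  shows "h x = k x"
proof -
  have c: "continuous_on S (\<lambda>x. h x - k x)" for S
    using assms(2,3) by (intro continuous_on_subset[OF continuous_on_diff]) auto
  have "closed {y. h y - k y = 0}"
    using continuous_closed_preimage[OF c[of UNIV] closed_UNIV, of "{0}"] by (simp add: vimage_def)
  moreover have "AE y \<in> U in lebesgue. y \<in> {y. h y - k y = 0}"
    using ae by (simp add: AE_completion_iff)
  ultimately have "y \<in> {y. h y - k y = 0}" if "y \<in> U" for y
    by (rule mem_closed_if_AE_lebesgue_open[OF \<open>open U\<close> _ _ that])
  then have "h x - k x = 0"
    by (intro continuous_constant_on_closure[OF c _ x]) auto
  then show ?thesis by simp
qed

lemma integrable_conformal:
  fixes g :: "real^2 \<Rightarrow> 'b::{banach, second_countable_topology}"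
  assumes "a\<^sup>2 + b\<^sup>2 \<noteq> 0" and "integrable lborel g"
  shows "integrable lborel (\<lambda>z. g (x0 + conformal a b z))"
proof -
  have [measurable]: "g \<in> borel_measurable borel" using assms(2) by auto
  have "(\<integral>\<^sup>+z. ennreal (norm (g (x0 + conformal a b z))) \<partial>lborel) < \<infinity>"
    using assms by (subst nn_integral_conformal[OF assms(1)]) (auto simp: integrable_iff_bounded ennreal_mult_less_top)
  then show ?thesis by (auto simp: integrable_iff_bounded)
qed

lemma norm_square_plane: "(norm (z :: real^2))\<^sup>2 = (z $ 1)\<^sup>2 + (z $ 2)\<^sup>2"
  by (simp add: norm_vec_def L2_set_def sum_2)

lemma norm_conformal: "norm (conformal a b z) = sqrt (a\<^sup>2 + b\<^sup>2) * norm z"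
proof -
  have "(norm (conformal a b z))\<^sup>2 = (a\<^sup>2 + b\<^sup>2) * (norm z)\<^sup>2"
    by (simp add: norm_square_plane) (simp add: power2_eq_square algebra_simps)
  then show ?thesis
    by (metis norm_ge_zero real_sqrt_abs real_sqrt_mult abs_norm_cancel)
qed


lemma perp_diff: "perp (x - y) = perp x - perp y"
  by (simp add: vec_eq_iff forall_2)

text \<open>For \<open>f = g\<close> this is the integral over \<open>z\<close> of \<open>f(\<xi> + z) f(\<xi> + l z\<^sup>\<bottom>) \<phi>(\<xi> + z + l z\<^sup>\<bottom>)\<close>
  after the substitution \<open>u = \<xi> + z\<close>, which leaves \<open>\<xi>\<close> in only one of the two factors from L2.
  Continuity in \<open>\<xi>\<close> then follows by approximating that single factor.\<close>
definition rectangle_integral ::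
    "real \<Rightarrow> (real^2 \<Rightarrow> complex) \<Rightarrow> (real^2 \<Rightarrow> complex) \<Rightarrow> (real^2 \<Rightarrow> complex) \<Rightarrow> real^2 \<Rightarrow> complex" where
  "rectangle_integral l f g \<phi> \<xi> =
     (LINT u|lborel. f u * g (\<xi> + l *\<^sub>R perp (u - \<xi>)) * \<phi> (u + l *\<^sub>R perp (u - \<xi>)))"

text \<open>Young's inequality \<open>a b \<le> (t a\<^sup>2 + b\<^sup>2 / t) / 2\<close> in place of the Cauchy--Schwarz inequality; the
  bound is small if \<open>t\<close> and \<open>L2_norm g\<close> are both small and of the same size. The divisor \<open>l\<^sup>2\<close> is
  the Jacobian of \<open>u \<mapsto> l u\<^sup>\<bottom>\<close>.\<close>
lemma rectangle_integral_bound: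
  assumes f: "f \<in> L2" and g: "g \<in> L2" and [measurable]: "\<phi> \<in> borel_measurable borel"
    and B: "\<And>x. cmod (\<phi> x) \<le> B" and l: "l \<noteq> 0" and t: "t > 0"
  shows "integrable lborel (\<lambda>u. f u * g (\<xi> + l *\<^sub>R perp (u - \<xi>)) * \<phi> (u + l *\<^sub>R perp (u - \<xi>)))" (is "integrable _ ?I")
    and "cmod (rectangle_integral l f g \<phi> \<xi>) \<le> B / 2 * (t * (L2_norm f)\<^sup>2 + (L2_norm g)\<^sup>2 / (t * l\<^sup>2))"
proof -
  note [measurable] = L2_measurable[OF f] L2_measurable[OF g]
  have B0: "0 \<le> B" using B norm_ge_zero order_trans by blast
  have nz: "0\<^sup>2 + l\<^sup>2 \<noteq> 0" using l by simp
  have sh: "\<xi> + l *\<^sub>R perp (u - \<xi>) = (\<xi> - l *\<^sub>R perp \<xi>) + conformal 0 l u" for u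
    by (simp add: conformal_def perp_diff algebra_simps)
  have if2: "integrable lborel (\<lambda>u. (cmod (f u))\<^sup>2)" and ig: "integrable lborel (\<lambda>u. (cmod (g u))\<^sup>2)"
    using f g by (auto simp: L2_def)
  have ig': "integrable lborel (\<lambda>u. (cmod (g (\<xi> + l *\<^sub>R perp (u - \<xi>))))\<^sup>2)"
    unfolding sh by (rule integrable_conformal[OF nz ig])
  have vg: "(LINT u|lborel. (cmod (g (\<xi> + l *\<^sub>R perp (u - \<xi>))))\<^sup>2) = (L2_norm g)\<^sup>2 / l\<^sup>2"
    unfolding sh using integral_conformal[OF nz, of "\<lambda>u. (cmod (g u))\<^sup>2"]
    by (simp add: L2_norm_def)
  let ?w = "\<lambda>u. B / 2 * (t * (cmod (f u))\<^sup>2 + (cmod (g (\<xi> + l *\<^sub>R perp (u - \<xi>))))\<^sup>2 / t)"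
  have bd: "cmod (?I u) \<le> ?w u" for u
  proof -
    have young: "a * b \<le> (t * a\<^sup>2 + b\<^sup>2 / t) / 2" for a b :: real
    proof -
      have "0 \<le> (t * a - b)\<^sup>2 / t" using t by simp
      also have "\<dots> = t * a\<^sup>2 + b\<^sup>2 / t - 2 * (a * b)"
        using t by (simp add: power2_diff diff_divide_distrib add_divide_distrib) (simp add: power2_eq_square)
      finally show ?thesis by simp
    qed
    have "cmod (?I u) \<le> (cmod (f u) * cmod (g (\<xi> + l *\<^sub>R perp (u - \<xi>)))) * B"
      unfolding norm_mult by (intro mult_left_mono B) simp
    also have "\<dots> \<le> (t * (cmod (f u))\<^sup>2 + (cmod (g (\<xi> + l *\<^sub>R perp (u - \<xi>))))\<^sup>2 / t) / 2 * B"
      by (intro mult_right_mono young B0)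
    finally show ?thesis by (simp add: mult_ac)
  qed
  have iw: "integrable lborel ?w"
    using if2 ig' by (intro integrable_mult_right Bochner_Integration.integrable_add integrable_divide)
  show int: "integrable lborel ?I"
    using iw
  proof (rule Bochner_Integration.integrable_bound)
    show "?I \<in> borel_measurable lborel" by measurable
    show "AE u in lborel. norm (?I u) \<le> norm (?w u)"
      unfolding real_norm_def by (intro AE_I2 order_trans[OF bd abs_ge_self])
  qed
  have "cmod (rectangle_integral l f g \<phi> \<xi>) \<le> (LINT u|lborel. ?w u)"
    unfolding rectangle_integral_def
    by (rule Bochner_Integration.integral_norm_bound_integral[OF int iw bd])
  also have "\<dots> = B / 2 * (t * (L2_norm f)\<^sup>2 + (L2_norm g)\<^sup>2 / (t * l\<^sup>2))"
    using if2 ig' by (simp add: vg) (simp add: L2_norm_def mult_ac)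
  finally show "cmod (rectangle_integral l f g \<phi> \<xi>) \<le> B / 2 * (t * (L2_norm f)\<^sup>2 + (L2_norm g)\<^sup>2 / (t * l\<^sup>2))" .
qed

lemma continuous_imp_L2:
  assumes g: "continuous_on UNIV g" "\<And>x. r < norm x \<Longrightarrow> g x = 0" "bounded (range g)"
  shows "g \<in> L2"
proof -
  have [measurable]: "g \<in> borel_measurable borel" by (rule borel_measurable_continuous_onI[OF g(1)])
  obtain B where B: "\<And>x. cmod (g x) \<le> B" using g(3) by (auto simp: bounded_iff)
  have "(\<integral>\<^sup>+x. ennreal ((cmod (g x))\<^sup>2) \<partial>lborel) \<le> (\<integral>\<^sup>+x. ennreal (B\<^sup>2) * indicator (cball (0::real^2) r) x \<partial>lborel)"
  proof (rule nn_integral_mono)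
    fix x
    have "(cmod (g x))\<^sup>2 \<le> B\<^sup>2" by (intro power_mono B) simp
    moreover have "g x = 0" if "x \<notin> cball 0 r" using that g(2)[of x] by simp
    ultimately show "ennreal ((cmod (g x))\<^sup>2) \<le> ennreal (B\<^sup>2) * indicator (cball (0::real^2) r) x"
      by (cases "x \<in> cball 0 r") (auto intro: ennreal_leI)
  qed
  also have "\<dots> < \<infinity>"
    using emeasure_bounded_finite[OF bounded_cball, of "0::real^2" r]
    by (subst nn_integral_cmult_indicator) (auto simp: ennreal_mult_less_top)
  finally show ?thesis by (simp add: L2_iff_nn_integral)
qed

lemma L2_locally_integrable:
  assumes f: "f \<in> L2"
  shows "integrable lborel (\<lambda>u. cmod (f u) * indicator (cball 0 r) u)"
proof (rule Bochner_Integration.integrable_bound)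
  note [measurable] = L2_measurable[OF f]
  have [measurable]: "(\<lambda>u. indicat_real (cball (0::real^2) r) u) \<in> borel_measurable borel"
    by (intro borel_measurable_indicator) simp
  show "integrable lborel (\<lambda>u. (cmod (f u))\<^sup>2 + indicat_real (cball 0 r) u)"
    using f emeasure_bounded_finite[OF bounded_cball, of "0::real^2" r]
    by (intro Bochner_Integration.integrable_add integrable_real_indicator) (auto simp: L2_def)
  show "(\<lambda>u. cmod (f u) * indicator (cball 0 r) u) \<in> borel_measurable lborel"
    by simp
  have "x \<le> x\<^sup>2 + 1" for x :: real
    using sum_squares_bound[of x 1] by (cases "x \<ge> 0") (auto intro: order_trans[of _ "0"])
  then show "AE u in lborel. norm (cmod (f u) * indicator (cball 0 r) u) \<le> norm ((cmod (f u))\<^sup>2 + indicat_real (cball 0 r) u)"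
    by (intro AE_I2) (auto simp: indicator_def)
qed

text \<open>For bounded \<open>\<xi>\<close> the support of \<open>\<phi>\<close> confines \<open>u\<close> to a ball, because
  \<open>norm u \<le> norm (u + l u\<^sup>\<bottom>)\<close>. On a ball \<open>f\<close> is integrable, and dominated convergence applies.\<close>
lemma continuous_rectangle_integral_of_continuous:
  assumes f: "f \<in> L2" and g: "continuous_on UNIV g" "bounded (range g)"
    and \<phi>: "continuous_on UNIV \<phi>" "\<And>x. r < norm x \<Longrightarrow> \<phi> x = 0" "bounded (range \<phi>)"
  shows "continuous_on UNIV (rectangle_integral l f g \<phi>)"
proof (intro continuous_at_imp_continuous_on ballI continuous_at_sequentiallyI)
  fix \<xi> :: "real^2" and s assume s: "s \<longlonglongrightarrow> \<xi>"
  note [measurable] = L2_measurable[OF f] borel_measurable_continuous_onI[OF g(1)] borel_measurable_continuous_onI[OF \<phi>(1)]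
  obtain B where B: "\<And>x. cmod (g x) \<le> B" using g(2) by (auto simp: bounded_iff)
  obtain C where C: "\<And>x. cmod (\<phi> x) \<le> C" using \<phi>(3) by (auto simp: bounded_iff)
  have "bounded (range s)" using s by (metis convergent_def convergent_imp_bounded)
  then obtain S where S: "\<And>n. norm (s n) \<le> S" by (auto simp: bounded_iff)
  define \<rho> where "\<rho> = r + \<bar>l\<bar> * S"
  have np: "norm (perp x) = norm x" for x using norm_conformal[of 0 1 x] by (simp add: conformal_def)
  let ?I = "\<lambda>\<xi> u. f u * g (\<xi> + l *\<^sub>R perp (u - \<xi>)) * \<phi> (u + l *\<^sub>R perp (u - \<xi>))"
  have "(\<lambda>n. LINT u|lborel. ?I (s n) u) \<longlonglongrightarrow> (LINT u|lborel. ?I \<xi> u)"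
  proof (rule integral_dominated_convergence[where w = "\<lambda>u. B * C * (cmod (f u) * indicator (cball 0 \<rho>) u)"])
    show "integrable lborel (\<lambda>u. B * C * (cmod (f u) * indicator (cball 0 \<rho>) u))"
      by (intro integrable_mult_right L2_locally_integrable f)
    show "AE u in lborel. (\<lambda>n. ?I (s n) u) \<longlonglongrightarrow> ?I \<xi> u"
    proof (intro AE_I2 tendsto_intros)
      fix u
      have c: "continuous_on UNIV (\<lambda>\<xi>. g (\<xi> + l *\<^sub>R perp (u - \<xi>)))" "continuous_on UNIV (\<lambda>\<xi>. \<phi> (u + l *\<^sub>R perp (u - \<xi>)))"
        by (intro continuous_on_compose2[OF g(1)] continuous_on_compose2[OF \<phi>(1)] continuous_intros; simp)+
      show "(\<lambda>n. g (s n + l *\<^sub>R perp (u - s n))) \<longlonglongrightarrow> g (\<xi> + l *\<^sub>R perp (u - \<xi>))"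
        by (rule continuous_on_tendsto_compose[OF c(1) s]) simp_all
      show "(\<lambda>n. \<phi> (u + l *\<^sub>R perp (u - s n))) \<longlonglongrightarrow> \<phi> (u + l *\<^sub>R perp (u - \<xi>))"
        by (rule continuous_on_tendsto_compose[OF c(2) s]) simp_all
    qed
    show "AE u in lborel. norm (?I (s n) u) \<le> B * C * (cmod (f u) * indicator (cball 0 \<rho>) u)" for n
    proof (rule AE_I2)
      fix u
      show "norm (?I (s n) u) \<le> B * C * (cmod (f u) * indicator (cball 0 \<rho>) u)"
      proof (cases "norm (u + l *\<^sub>R perp (u - s n)) \<le> r")
        case True
        have "norm u \<le> sqrt (1\<^sup>2 + l\<^sup>2) * norm u"
          by (simp add: mult_le_cancel_right1)
        also have "\<dots> = norm (conformal 1 l u)"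
          by (rule norm_conformal[symmetric])
        also have "conformal 1 l u = (u + l *\<^sub>R perp (u - s n)) + l *\<^sub>R perp (s n)"
          by (simp add: conformal_def perp_diff algebra_simps)
        also have "norm \<dots> \<le> r + \<bar>l\<bar> * norm (s n)"
          by (rule order_trans[OF norm_triangle_ineq add_mono[OF True]]) (simp add: np)
        also have "\<dots> \<le> \<rho>"
          unfolding \<rho>_def by (intro add_left_mono mult_left_mono S) simp
        finally have "u \<in> cball 0 \<rho>" by simp
        moreover have "norm (?I (s n) u) \<le> cmod (f u) * B * C"
          unfolding norm_mult using order_trans[OF norm_ge_zero B] by (intro mult_mono B C) auto
        ultimately show ?thesis by (simp add: mult_ac)
      next
        case False
        moreover have "0 \<le> B" "0 \<le> C" using order_trans[OF norm_ge_zero B] order_trans[OF norm_ge_zero C] by auto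
        ultimately show ?thesis using \<phi>(2) by (simp add: not_le)
      qed
    qed
  qed measurable
  then show "(\<lambda>n. rectangle_integral l f g \<phi> (s n)) \<longlonglongrightarrow> rectangle_integral l f g \<phi> \<xi>"
    by (simp add: rectangle_integral_def)
qed

text \<open>A uniform limit of the integrals in which the second \<open>f\<close> is replaced by continuous functions
  that converge to \<open>f\<close> in L2.\<close>
lemma continuous_rectangle_integral:
  assumes f: "f \<in> L2" and l: "l \<noteq> 0"
    and \<phi>: "continuous_on UNIV \<phi>" "\<And>x. r < norm x \<Longrightarrow> \<phi> x = 0" "bounded (range \<phi>)"
  shows "continuous_on UNIV (rectangle_integral l f f \<phi>)"
proof -
  note [measurable] = L2_measurable[OF f] borel_measurable_continuous_onI[OF \<phi>(1)]
  obtain B where B: "\<And>x. cmod (\<phi> x) \<le> B" using \<phi>(3) by (auto simp: bounded_iff)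
  have B0: "0 \<le> B" using order_trans[OF norm_ge_zero B] .
  \<comment> \<open>\<open>s n\<close> serves both as the quality of the approximation and as the weight in Young's inequality.\<close>
  define s :: "nat \<Rightarrow> real" where "s n = 1 / real (Suc n)" for n
  have s: "s n > 0" for n by (simp add: s_def)
  have "\<exists>g r. continuous_on UNIV g \<and> (\<forall>x. r < norm x \<longrightarrow> g x = 0) \<and> bounded (range g) \<and>
      L2sq (\<lambda>x. f x - g x) < ennreal ((s n)\<^sup>2)" for n
  proof -
    have "ennreal ((s n)\<^sup>2) > 0" using s[of n] by simp
    from L2_dense_compact_support[OF f this] show ?thesis by metis
  qed
  then obtain g r' where g: "\<And>n. continuous_on UNIV (g n)" "\<And>n x. r' n < norm x \<Longrightarrow> g n x = 0" "\<And>n. bounded (range (g n))"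
      "\<And>n. L2sq (\<lambda>x. f x - g n x) < ennreal ((s n)\<^sup>2)"
    by metis
  have gL2: "g n \<in> L2" for n using continuous_imp_L2[OF g(1-3)] .
  note [measurable] = L2_measurable[OF gL2]
  have dL2: "(\<lambda>x. f x - g n x) \<in> L2" for n
    using g(4)[of n] by (subst L2_iff_nn_integral) (auto simp: L2sq_def intro: less_trans)
  have dn: "(L2_norm (\<lambda>x. f x - g n x))\<^sup>2 \<le> (s n)\<^sup>2" for n
    using g(4)[of n] unfolding L2sq_def L2_nn_integral[OF dL2] by (simp add: ennreal_less_iff)
  define C where "C = B / 2 * ((L2_norm f)\<^sup>2 + 1 / l\<^sup>2)"
  have bound: "dist (rectangle_integral l f (g n) \<phi> \<xi>) (rectangle_integral l f f \<phi> \<xi>) \<le> s n * C" for n \<xi>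
  proof -
    have "rectangle_integral l f f \<phi> \<xi> - rectangle_integral l f (g n) \<phi> \<xi> =
        rectangle_integral l f (\<lambda>x. f x - g n x) \<phi> \<xi>"
      unfolding rectangle_integral_def
    proof (subst Bochner_Integration.integral_diff[symmetric])
      show "integrable lborel (\<lambda>u. f u * f (\<xi> + l *\<^sub>R perp (u - \<xi>)) * \<phi> (u + l *\<^sub>R perp (u - \<xi>)))"
        "integrable lborel (\<lambda>u. f u * g n (\<xi> + l *\<^sub>R perp (u - \<xi>)) * \<phi> (u + l *\<^sub>R perp (u - \<xi>)))"
        by (rule rectangle_integral_bound(1)[OF f _ _ B l zero_less_one], rule f gL2, measurable)+
    qed (intro Bochner_Integration.integral_cong refl, simp add: left_diff_distrib right_diff_distrib)
    also have "cmod \<dots> \<le> B / 2 * (s n * (L2_norm f)\<^sup>2 + (L2_norm (\<lambda>x. f x - g n x))\<^sup>2 / (s n * l\<^sup>2))"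
      by (rule rectangle_integral_bound(2)[OF f dL2 _ B l s]) measurable
    also have "\<dots> \<le> B / 2 * (s n * (L2_norm f)\<^sup>2 + (s n)\<^sup>2 / (s n * l\<^sup>2))"
      using s[of n] by (intro mult_left_mono add_left_mono divide_right_mono dn) (use B0 in auto)
    also have "\<dots> = s n * C"
      using s[of n] by (simp add: C_def power2_eq_square algebra_simps)
    finally show ?thesis by (simp add: dist_norm norm_minus_commute)
  qed
  have "(\<lambda>n. s n * C) \<longlonglongrightarrow> 0"
    using tendsto_mult_left_zero[OF LIMSEQ_Suc[OF lim_1_over_n], of C] by (simp add: s_def)
  then have "uniform_limit UNIV (\<lambda>n. rectangle_integral l f (g n) \<phi>) (rectangle_integral l f f \<phi>) sequentially"
    by (intro uniform_limitI) (auto dest!: order_tendstoD(2) elim!: eventually_mono intro: le_less_trans[OF bound])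
  moreover have "continuous_on UNIV (rectangle_integral l f (g n) \<phi>)" for n
    by (rule continuous_rectangle_integral_of_continuous[OF f g(1,3) \<phi>])
  ultimately show ?thesis
    by (intro uniform_limit_theorem[where F = sequentially]) auto
qed


section \<open>A continuous representative of an extremizer\<close>

lemma slices_of_equality:
  assumes "AE p in lborel. p \<in> rectangles \<longrightarrow> diagonal1 f p = diagonal2 f p"
  shows "AE l in lborel. l \<in> {-1..1} \<longrightarrow>
    (AE \<xi> in lborel. AE z in lborel. f (\<xi> + z) * f (\<xi> + l *\<^sub>R perp z) = f (\<xi> + z + l *\<^sub>R perp z) * f \<xi>)"
proof -
  have "AE p in (lborel \<Otimes>\<^sub>M lborel). p \<in> rectangles \<longrightarrow> diagonal1 f p = diagonal2 f p"
    unfolding lborel_prod by (rule assms)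
  then have "AE l in lborel. AE q in lborel. (l, q) \<in> rectangles \<longrightarrow> diagonal1 f (l, q) = diagonal2 f (l, q)"
    by (rule lborel_pair.AE_pair)
  then show ?thesis
  proof eventually_elim
    case (elim l)
    show ?case
    proof
      assume "l \<in> {-1..1}"
      with elim have "AE q in (lborel \<Otimes>\<^sub>M lborel). diagonal1 f (l, q) = diagonal2 f (l, q)"
        unfolding lborel_prod by simp
      from lborel_pair.AE_pair[OF this]
      show "AE \<xi> in lborel. AE z in lborel. f (\<xi> + z) * f (\<xi> + l *\<^sub>R perp z) = f (\<xi> + z + l *\<^sub>R perp z) * f \<xi>"
        by (simp add: diagonal1_def diagonal2_def)
    qed
  qed
qed

text \<open>Take the conjugate of a test function \<open>g\<close> that is closer to \<open>f\<close> than \<open>0\<close> is: if \<open>f\<close> and \<open>g\<close>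
  were orthogonal, their distance would be at least the norm of \<open>f\<close>.\<close>
lemma nonorthogonal_test_function:
  assumes f: "f \<in> L2" and nz: "L2_norm f > 0"
  obtains \<phi> r where "continuous_on UNIV \<phi>" "\<And>x. r < norm x \<Longrightarrow> \<phi> x = 0" "bounded (range \<phi>)"
    "(LINT x|lborel. f x * \<phi> x) \<noteq> 0"
proof -
  note [measurable] = L2_measurable[OF f]
  have "ennreal ((L2_norm f)\<^sup>2) > 0" using nz by simp
  from L2_dense_compact_support[OF f this]
  obtain g r where g: "continuous_on UNIV g" "\<And>x. r < norm x \<Longrightarrow> g x = 0" "bounded (range g)"
    and less: "L2sq (\<lambda>x. f x - g x) < ennreal ((L2_norm f)\<^sup>2)" by metis
  note [measurable] = borel_measurable_continuous_onI[OF g(1)]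
  have gL2: "g \<in> L2" by (rule continuous_imp_L2[OF g])
  have if2: "integrable lborel (\<lambda>u. (cmod (f u))\<^sup>2)" and ig2: "integrable lborel (\<lambda>u. (cmod (g u))\<^sup>2)"
    using f gL2 by (auto simp: L2_def)
  have prod_le: "cmod (x * cnj y) \<le> (cmod x)\<^sup>2 + (cmod y)\<^sup>2" for x y
    using sum_squares_bound[of "cmod x" "cmod y"] mult_nonneg_nonneg[OF norm_ge_zero norm_ge_zero, of x y]
    unfolding norm_mult complex_mod_cnj by linarith
  have ip: "integrable lborel (\<lambda>x. f x * cnj (g x))"
  proof (rule Bochner_Integration.integrable_bound)
    show "integrable lborel (\<lambda>x. (cmod (f x))\<^sup>2 + (cmod (g x))\<^sup>2)"
      by (intro Bochner_Integration.integrable_add if2 ig2)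
    show "(\<lambda>x. f x * cnj (g x)) \<in> borel_measurable lborel" by measurable
    show "AE x in lborel. norm (f x * cnj (g x)) \<le> norm ((cmod (f x))\<^sup>2 + (cmod (g x))\<^sup>2)"
      unfolding real_norm_def by (intro AE_I2 order_trans[OF prod_le abs_ge_self])
  qed
  have ne: "(LINT x|lborel. f x * cnj (g x)) \<noteq> 0"
  proof
    assume zero: "(LINT x|lborel. f x * cnj (g x)) = 0"
    have ir: "integrable lborel (\<lambda>x. Re (f x * cnj (g x)))" using ip by (rule integrable_Re)
    have "(LINT x|lborel. Re (f x * cnj (g x))) = 0"
      using ip zero by (simp only: integral_Re) simp
    then have r0: "(LINT x|lborel. 2 * Re (f x * cnj (g x))) = 0"
      by (simp only: integral_mult_right_zero mult_zero_right)
    have expand: "(cmod (f x - g x))\<^sup>2 = (cmod (f x))\<^sup>2 + (cmod (g x))\<^sup>2 - 2 * Re (f x * cnj (g x))" for x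
      by (simp add: cmod_power2, simp add: power2_eq_square algebra_simps)
    have id: "integrable lborel (\<lambda>x. (cmod (f x - g x))\<^sup>2)"
      unfolding expand using if2 ig2 ir
      by (intro Bochner_Integration.integrable_add Bochner_Integration.integrable_diff integrable_mult_right)
    have "(LINT x|lborel. (cmod (f x - g x))\<^sup>2) = (LINT x|lborel. (cmod (f x))\<^sup>2) + (LINT x|lborel. (cmod (g x))\<^sup>2) - (LINT x|lborel. 2 * Re (f x * cnj (g x)))"
      unfolding expand using if2 ig2 ir
      by (subst Bochner_Integration.integral_diff; (intro Bochner_Integration.integrable_add integrable_mult_right)?; simp)
    also have "\<dots> \<ge> (L2_norm f)\<^sup>2"
      unfolding r0 by (simp add: L2_norm_def)
    finally have "(L2_norm f)\<^sup>2 \<le> (LINT x|lborel. (cmod (f x - g x))\<^sup>2)" .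
    moreover have "L2sq (\<lambda>x. f x - g x) = ennreal (LINT x|lborel. (cmod (f x - g x))\<^sup>2)"
      unfolding L2sq_def by (rule nn_integral_eq_integral[OF id]) simp
    ultimately show False
      using less by (simp add: ennreal_less_iff)
  qed
  show thesis
  proof
    show "continuous_on UNIV (\<lambda>x. cnj (g x))" by (intro continuous_intros g)
    show "cnj (g x) = 0" if "r < norm x" for x using g(2)[OF that] by simp
    show "bounded (range (\<lambda>x. cnj (g x)))" using g(3) by (simp add: bounded_iff)
  qed (rule ne)
qed

text \<open>For one value \<open>l > 0\<close> at which the functional equation holds for almost all \<open>\<xi>\<close> and \<open>z\<close>, integrate
  the equation against a test function at the vertex \<open>\<xi> + z + l z\<^sup>\<bottom>\<close>. One side is the constant
  \<open>(\<integral> f \<phi>) / (1 + l\<^sup>2)\<close> times \<open>f(\<xi>)\<close>, the other is a continuous rectangle integral.\<close>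
theorem continuous_representative:
  assumes f: "f \<in> L2" and nz: "L2_norm f > 0"
    and eq: "AE p in lborel. p \<in> rectangles \<longrightarrow> diagonal1 f p = diagonal2 f p"
  obtains F where "continuous_on UNIV F" "AE x in lborel. f x = F x"
proof -
  note [measurable] = L2_measurable[OF f]
  let ?E = "\<lambda>l \<xi> z. f (\<xi> + z) * f (\<xi> + l *\<^sub>R perp z) = f (\<xi> + z + l *\<^sub>R perp z) * f \<xi>"
  have "\<exists>l. l \<in> {0<..<1} \<and> (AE \<xi> in lborel. AE z in lborel. ?E l \<xi> z)"
  proof (rule ccontr)
    assume "\<not> ?thesis"
    then have "AE l in lborel. l \<notin> {0<..<1::real}"
      using slices_of_equality[OF eq] by (auto elim!: eventually_mono)
    then have "emeasure lborel {0<..<1::real} = 0"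
      by (subst (asm) AE_iff_measurable[of "{0<..<1}"]) auto
    then show False by simp
  qed
  then obtain l where l: "0 < l" and E: "AE \<xi> in lborel. AE z in lborel. ?E l \<xi> z" by auto
  obtain \<phi> r where \<phi>: "continuous_on UNIV \<phi>" "\<And>x. r < norm x \<Longrightarrow> \<phi> x = 0" "bounded (range \<phi>)"
    and c: "(LINT x|lborel. f x * \<phi> x) \<noteq> 0"
    using nonorthogonal_test_function[OF f nz] by metis
  note [measurable] = borel_measurable_continuous_onI[OF \<phi>(1)]
  define c where "c = (LINT x|lborel. f x * \<phi> x) / (1 + l\<^sup>2)"
  have pos: "1 + l\<^sup>2 > 0" by (simp add: add_pos_nonneg)
  have c0: "c \<noteq> 0"
    using \<open>(LINT x|lborel. f x * \<phi> x) \<noteq> 0\<close> pos unfolding c_def by (simp add: complex_eq_iff)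
  have "AE \<xi> in lborel. f \<xi> * c = rectangle_integral l f f \<phi> \<xi>"
    using E
  proof eventually_elim
    case (elim \<xi>)
    have "rectangle_integral l f f \<phi> \<xi> =
        (LINT z|lborel. f (\<xi> + z) * f (\<xi> + l *\<^sub>R perp z) * \<phi> (\<xi> + z + l *\<^sub>R perp z))"
      unfolding rectangle_integral_def
      using integral_conformal[of 1 0 "\<lambda>u. f u * f (\<xi> + l *\<^sub>R perp (u - \<xi>)) * \<phi> (u + l *\<^sub>R perp (u - \<xi>))" \<xi>]
      by (simp add: conformal_def)
    also have "\<dots> = (LINT z|lborel. f \<xi> * (f (\<xi> + conformal 1 l z) * \<phi> (\<xi> + conformal 1 l z)))"
    proof (rule integral_cong_AE)
      show "AE z in lborel. f (\<xi> + z) * f (\<xi> + l *\<^sub>R perp z) * \<phi> (\<xi> + z + l *\<^sub>R perp z) =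
          f \<xi> * (f (\<xi> + conformal 1 l z) * \<phi> (\<xi> + conformal 1 l z))"
        using elim by eventually_elim (simp add: conformal_def add.assoc mult_ac)
    qed measurable
    also have "\<dots> = f \<xi> * (LINT z|lborel. f (\<xi> + conformal 1 l z) * \<phi> (\<xi> + conformal 1 l z))"
      by simp
    also have "(LINT z|lborel. f (\<xi> + conformal 1 l z) * \<phi> (\<xi> + conformal 1 l z)) = (1 / (1\<^sup>2 + l\<^sup>2)) *\<^sub>R (LINT x|lborel. f x * \<phi> x)"
      using pos by (intro integral_conformal) auto
    also have "\<dots> = c"
      by (simp add: c_def scaleR_conv_of_real)
    finally show ?case by simp
  qed
  then have "AE \<xi> in lborel. f \<xi> = rectangle_integral l f f \<phi> \<xi> / c"
    by eventually_elim (use c0 in \<open>simp add: field_simps\<close>)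
  moreover have "continuous_on UNIV (\<lambda>\<xi>. rectangle_integral l f f \<phi> \<xi> / c)"
    using continuous_rectangle_integral[OF f _ \<phi>] l c0 by (intro continuous_on_divide continuous_on_const) auto
  ultimately show thesis using that by blast
qed

text \<open>The longer leg of a right angle serves as \<open>z\<close>, so that the ratio \<open>l\<close> lies in the interval
  \<open>[-1, 1]\<close> over which the Hamiltonian integrates.\<close>
lemma orthogonal_plane:
  fixes x y :: "real^2"
  assumes "x \<noteq> 0" "x \<bullet> y = 0" "norm y \<le> norm x"
  obtains l where "l \<in> {-1..1}" "y = l *\<^sub>R perp x"
proof -
  have n: "norm x > 0" using assms(1) by simp
  define l where "l = (x $ 1 * y $ 2 - x $ 2 * y $ 1) / (norm x)\<^sup>2"
  have o: "x $ 1 * y $ 1 + x $ 2 * y $ 2 = 0"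
    using assms(2) by (simp add: inner_vec_def sum_2)
  have "(norm x)\<^sup>2 * y $ 1 = - (x $ 1 * y $ 2 - x $ 2 * y $ 1) * x $ 2"
  proof -
    have "(norm x)\<^sup>2 * y $ 1 + (x $ 1 * y $ 2 - x $ 2 * y $ 1) * x $ 2 = x $ 1 * (x $ 1 * y $ 1 + x $ 2 * y $ 2)"
      unfolding norm_square_plane by (simp add: power2_eq_square algebra_simps)
    then show ?thesis unfolding o by (simp add: algebra_simps)
  qed
  moreover have "(norm x)\<^sup>2 * y $ 2 = (x $ 1 * y $ 2 - x $ 2 * y $ 1) * x $ 1"
  proof -
    have "(norm x)\<^sup>2 * y $ 2 - (x $ 1 * y $ 2 - x $ 2 * y $ 1) * x $ 1 = x $ 2 * (x $ 1 * y $ 1 + x $ 2 * y $ 2)"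
      unfolding norm_square_plane by (simp add: power2_eq_square algebra_simps)
    then show ?thesis by (simp add: o)
  qed
  ultimately have y: "y = l *\<^sub>R perp x"
    using n by (simp add: vec_eq_iff forall_2 l_def field_simps)
  have "norm (perp x) = norm x" using norm_conformal[of 0 1 x] by (simp add: conformal_def)
  then have "\<bar>l\<bar> * norm x \<le> 1 * norm x" using assms(3) y by simp
  then have "\<bar>l\<bar> \<le> 1" using n by (rule mult_right_le_imp_le)
  then show thesis using that[of l] y by (auto simp: abs_le_iff)
qed

definition rectangle_multiplicative :: "(real^2 \<Rightarrow> complex) \<Rightarrow> bool" where
  "rectangle_multiplicative F \<longleftrightarrow> (\<forall>p x y. x \<bullet> y = 0 \<longrightarrow> F (p + x) * F (p + y) = F (p + x + y) * F p)"

theorem continuous_representative_rectangle_multiplicative: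
  assumes eq: "AE p in lborel. p \<in> rectangles \<longrightarrow> diagonal1 f p = diagonal2 f p"
    and F: "continuous_on UNIV F" and fF: "AE x in lborel. f x = F x"
  shows "rectangle_multiplicative F"
proof -
  let ?L = "\<lambda>l \<xi> z. F (\<xi> + z) * F (\<xi> + l *\<^sub>R perp z)"
  let ?R = "\<lambda>l \<xi> z. F (\<xi> + z + l *\<^sub>R perp z) * F \<xi>"
  note cF = continuous_on_compose2[OF F]
  have "AE l in lborel. l \<in> {-1<..<1} \<longrightarrow> (\<forall>\<xi> z. ?L l \<xi> z = ?R l \<xi> z)"
    using slices_of_equality[OF eq] AE_lborel_singleton[of 0]
  proof eventually_elim
    case (elim l)
    show ?case
    proof
      assume "l \<in> {-1<..<1}"
      with elim have E: "AE \<xi> in lborel. AE z in lborel. f (\<xi> + z) * f (\<xi> + l *\<^sub>R perp z) = f (\<xi> + z + l *\<^sub>R perp z) * f \<xi>"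
        by auto
      have nz: "0\<^sup>2 + l\<^sup>2 \<noteq> 0" "1\<^sup>2 + l\<^sup>2 \<noteq> 0" using elim by (auto simp: add_nonneg_eq_0_iff)
      have "AE \<xi> in lborel. \<forall>z. ?L l \<xi> z = ?R l \<xi> z"
        using E fF
      proof eventually_elim
        case (elim \<xi>)
        have "AE z in lborel. f (\<xi> + conformal 1 0 z) = F (\<xi> + conformal 1 0 z)"
          by (rule AE_lborel_conformal[OF _ fF]) simp
        moreover note AE_lborel_conformal[OF nz(1) fF, of \<xi>] AE_lborel_conformal[OF nz(2) fF, of \<xi>]
        ultimately have "AE z in lborel. ?L l \<xi> z = ?R l \<xi> z"
          using elim(1)
        proof eventually_elim
          case (elim z)
          then show ?case using \<open>f \<xi> = F \<xi>\<close> by (simp add: conformal_def add.assoc)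
        qed
        then have "?L l \<xi> z = ?R l \<xi> z" for z
          by (intro AE_eq_imp_eq_closure[where U = UNIV and h = "?L l \<xi>" and k = "?R l \<xi>"] continuous_intros cF) auto
        then show ?case by blast
      qed
      then have "AE \<xi> in lborel. ?L l \<xi> z = ?R l \<xi> z" for z
        by eventually_elim blast
      then have "?L l \<xi> z = ?R l \<xi> z" for \<xi> z
        by (intro AE_eq_imp_eq_closure[where U = UNIV and h = "\<lambda>\<xi>. ?L l \<xi> z" and k = "\<lambda>\<xi>. ?R l \<xi> z"] continuous_intros cF) auto
      then show "\<forall>\<xi> z. ?L l \<xi> z = ?R l \<xi> z" by blast
    qed
  qed
  then have "AE l in lborel. l \<in> {-1<..<1} \<longrightarrow> ?L l \<xi> z = ?R l \<xi> z" for \<xi> z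
    by eventually_elim blast
  then have *: "?L l \<xi> z = ?R l \<xi> z" if "l \<in> {-1..1}" for l \<xi> z
    using that
    by (intro AE_eq_imp_eq_closure[where U = "{-1<..<1}" and h = "\<lambda>l. ?L l \<xi> z" and k = "\<lambda>l. ?R l \<xi> z"] continuous_intros cF) auto
  show ?thesis
    unfolding rectangle_multiplicative_def
  proof (intro allI impI)
    fix p x y :: "real^2" assume xy: "x \<bullet> y = 0"
    consider "x = 0" | "y = 0" | "x \<noteq> 0" "norm y \<le> norm x" | "y \<noteq> 0" "norm x \<le> norm y" by linarith
    then show "F (p + x) * F (p + y) = F (p + x + y) * F p"
    proof cases
      case 3
      with xy obtain l where "l \<in> {-1..1}" "y = l *\<^sub>R perp x" using orthogonal_plane by metis
      then show ?thesis using *[of l p x] by simp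
    next
      case 4
      with xy obtain l where "l \<in> {-1..1}" "x = l *\<^sub>R perp y" using orthogonal_plane by (metis inner_commute)
      then show ?thesis using *[of l p y] by (simp add: ac_simps)
    qed (auto simp: mult.commute)
  qed
qed


section \<open>The functional equation over rectangles\<close>

text \<open>Suppose there are zeros, and let \<open>p\<close> be one closest to \<open>q\<close>. The open disc around \<open>q\<close> through \<open>p\<close>
  contains two points that are seen from \<open>p\<close> at a right angle. They and \<open>p\<close> are vertices of a
  rectangle, and the equation says that \<open>F\<close> vanishes at one of the two, contradicting the choice
  of \<open>p\<close>.\<close>
lemma rectangle_multiplicative_nonzero:
  assumes F: "continuous_on UNIV F" and m: "rectangle_multiplicative F" and q: "F q \<noteq> 0"
  shows "F x \<noteq> 0"
proof
  assume x: "F x = 0"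
  have "closed {x. F x = 0}"
    using continuous_closed_preimage[OF F closed_UNIV, of "{0}"] by (simp add: vimage_def)
  then obtain p where p: "F p = 0" and near: "\<And>y. F y = 0 \<Longrightarrow> dist q p \<le> dist q y"
    using distance_attains_inf[of "{x. F x = 0}" q] x by auto
  define d where "d = q - p"
  have d: "d \<noteq> 0" using p q by (auto simp: d_def)
  have nz: "F (q + v) \<noteq> 0" if "norm v < norm d" for v
    using near[of "q + v"] that by (auto simp: dist_norm d_def norm_minus_commute)
  \<comment> \<open>The point \<open>p + d + \<eta> d\<^sup>\<bottom>\<close> lies in the disc for \<open>\<eta> < 1\<close>. At a right angle to it as seen from \<open>p\<close>
    is \<open>p + t \<eta> d - t d\<^sup>\<bottom>\<close>, which is closest to \<open>q\<close> for \<open>t = \<eta> / (1 + \<eta>\<^sup>2)\<close>. With \<open>\<eta> = 1/2\<close> these are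
    the two points below, written relative to \<open>q\<close>.\<close>
  have "norm (conformal 0 (1/2) d) < norm d" "norm (conformal (-4/5) (-2/5) d) < norm d"
    using d by (auto simp: norm_conformal power2_eq_square real_sqrt_lt_1_iff mult_less_cancel_right1 intro!: real_less_lsqrt)
  then have "F (q + conformal 0 (1/2) d) \<noteq> 0" "F (q + conformal (-4/5) (-2/5) d) \<noteq> 0"
    by (simp_all only: nz not_False_eq_True)
  moreover have "q + conformal 0 (1/2) d = p + conformal 1 (1/2) d" "q + conformal (-4/5) (-2/5) d = p + conformal (1/5) (-2/5) d"
    by (simp_all add: d_def vec_eq_iff forall_2 field_simps)
  moreover have "conformal 1 (1/2) d \<bullet> conformal (1/5) (-2/5) d = 0"
    by (simp add: inner_vec_def sum_2 field_simps)
  moreover have "F (p + u) * F (p + v) = F (p + u + v) * F p" if "u \<bullet> v = 0" for u v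
    using m that by (simp add: rectangle_multiplicative_def)
  ultimately show False using p by (metis mult_zero_right mult_eq_0_iff)
qed

definition rectangle_additive :: "(real^2 \<Rightarrow> complex) \<Rightarrow> bool" where
  "rectangle_additive g \<longleftrightarrow> (\<forall>p x y. x \<bullet> y = 0 \<longrightarrow> g (p + x) + g (p + y) = g (p + x + y) + g p)"

text \<open>The defect of additivity takes values in \<open>2 \<pi> \<i> \<int>\<close>. It is constant along the deformation that
  shrinks one side of the rectangle to a point, where the defect is zero.\<close>
lemma continuous_log_rectangle_additive:
  assumes F: "continuous_on UNIV F" and m: "rectangle_multiplicative F" and nz: "\<And>x. F x \<noteq> 0"
  obtains g where "continuous_on UNIV g" "\<And>x. F x = exp (g x)" "rectangle_additive g"
proof -
  obtain g where g: "continuous_on UNIV g" and Fg: "\<And>x. F x = exp (g x)"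
    using continuous_logarithm_on_contractible[OF F contractible_UNIV nz] by auto
  have "g (p + x) + g (p + y) = g (p + x + y) + g p" if xy: "x \<bullet> y = 0" for p x y
  proof -
    define D where "D s = g (p + s *\<^sub>R x) + g (p + y) - g (p + s *\<^sub>R x + y) - g p" for s :: real
    have cD: "continuous_on UNIV D"
      unfolding D_def by (intro continuous_intros continuous_on_compose2[OF g]) auto
    have D: "exp (D s) = 1" for s
    proof -
      have "F (p + s *\<^sub>R x) * F (p + y) = F (p + s *\<^sub>R x + y) * F p"
        using m xy by (simp add: rectangle_multiplicative_def)
      then show ?thesis by (simp add: D_def Fg exp_add exp_diff)
    qed
    have "D constant_on UNIV"
    proof (rule continuous_discrete_range_constant[OF connected_UNIV cD])
      fix s :: real
      have "2 * pi \<le> norm (D t - D s)" if "D t \<noteq> D s" for t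
      proof -
        have "exp (D t) = exp (D s)" by (simp add: D)
        then obtain n :: int where n: "D t = D s + of_int (2 * n) * of_real pi * \<i>"
          unfolding exp_eq by (auto simp: mult_ac)
        with that have "n \<noteq> 0" by auto
        then have "1 \<le> \<bar>real_of_int n\<bar>" by linarith
        then have "2 * pi * 1 \<le> 2 * pi * \<bar>real_of_int n\<bar>" by (intro mult_left_mono) auto
        with n show ?thesis by (simp add: norm_mult)
      qed
      then show "\<exists>e>0. \<forall>t. t \<in> UNIV \<and> D t \<noteq> D s \<longrightarrow> e \<le> norm (D t - D s)"
        by (intro exI[of _ "2 * pi"]) auto
    qed
    then have "D 1 = D 0" unfolding constant_on_def by auto
    then show ?thesis by (simp add: D_def algebra_simps)
  qed
  then show thesis using that[of g] g Fg by (simp add: rectangle_additive_def)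
qed

lemma continuous_additive_linear:
  fixes h :: "real \<Rightarrow> 'b::real_normed_vector"
  assumes h: "continuous_on UNIV h" and add: "\<And>x y. h (x + y) = h x + h y"
  shows "h x = x *\<^sub>R h 1"
proof -
  have h0: "h 0 = 0" using add[of 0 0] by simp
  have hneg: "h (- x) = - h x" for x using add[of x "- x"] h0 by (simp add: eq_neg_iff_add_eq_0 add.commute)
  have hnat: "h (of_nat n * x) = of_nat n *\<^sub>R h x" for n x
    by (induction n) (simp_all add: h0 add distrib_right scaleR_add_left)
  have hint: "h (of_int k * x) = of_int k *\<^sub>R h x" for k x
  proof (cases "k \<ge> 0")
    case True
    then show ?thesis using hnat[of "nat k" x] by simp
  next
    case False
    then show ?thesis using hnat[of "nat (- k)" x] hneg[of "of_int (-k) * x"] by simp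
  qed
  have "h r - r *\<^sub>R h 1 = 0" if "r \<in> \<rat>" for r
  proof -
    obtain a b :: int where b: "b \<noteq> 0" and r: "r = of_int a / of_int b"
      using \<open>r \<in> \<rat>\<close> by (metis Rats_cases' order_less_irrefl)
    have "of_int b *\<^sub>R h r = of_int a *\<^sub>R h 1"
      using hint[of b r] hint[of a 1] b r by simp
    then have "of_int b *\<^sub>R (h r - r *\<^sub>R h 1) = 0"
      using b r by (simp add: scaleR_diff_right)
    then show ?thesis using b by simp
  qed
  moreover have "continuous_on (closure \<rat>) (\<lambda>x. h x - x *\<^sub>R h 1)"
    unfolding Rats_closure_real by (intro continuous_intros h)
  moreover have "x \<in> closure \<rat>" by (simp add: Rats_closure_real)
  ultimately have "h x - x *\<^sub>R h 1 = 0"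
    using continuous_constant_on_closure[of "\<rat>" "\<lambda>x. h x - x *\<^sub>R h 1" 0 x] by blast
  then show ?thesis by simp
qed

text \<open>If the second difference of \<open>A\<close> does not depend on the base point, it is additive in each of the
  two increments. By continuity it is bilinear, and \<open>A\<close> minus half its diagonal is additive.\<close>
lemma constant_second_difference_quadratic:
  fixes A :: "real \<Rightarrow> complex"
  assumes A: "continuous_on UNIV A" and A0: "A 0 = 0"
    and diff: "\<And>p h k. A (p + h + k) - A (p + h) - A (p + k) + A p = A (h + k) - A h - A k"
  defines "\<beta> \<equiv> (A 2 - 2 * A 1) / 2"
  shows "A h = of_real h * (A 1 - \<beta>) + of_real (h\<^sup>2) * \<beta>"
proof -
  define B where "B h k = A (h + k) - A h - A k" for h k
  have cB: "continuous_on UNIV (\<lambda>h. B h k)" for k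
    unfolding B_def by (intro continuous_intros continuous_on_compose2[OF A]) auto
  have Badd: "B (h + h') k = B h k + B h' k" for h h' k
    using diff[of h h' k] by (simp add: B_def algebra_simps)
  have Bsym: "B h k = B k h" for h k by (simp add: B_def add.commute)
  have B: "B h k = of_real (h * k) * B 1 1" for h k
    using continuous_additive_linear[of "\<lambda>h. B h k", OF cB Badd] continuous_additive_linear[of "\<lambda>h. B h 1", OF cB Badd]
      Bsym by (metis scaleR_scaleR scaleR_conv_of_real)
  have B1: "B 1 1 = 2 * \<beta>" by (simp add: B_def \<beta>_def)
  define L where "L h = A h - of_real (h\<^sup>2) * \<beta>" for h
  have "L (h + k) = L h + L k" for h k
    using B[of h k] unfolding B1 by (simp add: L_def B_def power2_eq_square algebra_simps)
  moreover have "continuous_on UNIV L"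
    unfolding L_def by (intro continuous_intros A)
  ultimately have "L h = h *\<^sub>R L 1" by (intro continuous_additive_linear) auto
  then show ?thesis by (simp add: L_def scaleR_conv_of_real algebra_simps)
qed

text \<open>Rectangles with sides parallel to the axes split \<open>g\<close> into \<open>g 0 + A(x\<^sub>1) + B(x\<^sub>2)\<close>. Squares with
  sides \<open>(u, - v)\<close> and \<open>(v, u)\<close> at a corner \<open>(p, q)\<close> equate a second difference of \<open>A\<close> at \<open>p\<close>
  with one of \<open>B\<close> at \<open>q\<close>. As \<open>p\<close> and \<open>q\<close> vary independently, both are constant, so \<open>A\<close> and \<open>B\<close>
  are quadratic, and the two leading coefficients agree.\<close>
theorem rectangle_additive_quadratic:
  assumes g: "continuous_on UNIV g" and ra: "rectangle_additive g"
  obtains a b1 b2 c where "\<And>x. g x = c + b1 * of_real (x $ 1) + b2 * of_real (x $ 2) - a * of_real ((norm x)\<^sup>2)"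
proof -
  define P where "P s t = (vector [s, t] :: real^2)" for s t
  have P_nth [simp]: "P s t $ 1 = s" "P s t $ 2 = t" for s t by (simp_all add: P_def)
  have P_eq: "x = P (x $ 1) (x $ 2)" for x by (simp add: vec_eq_iff forall_2)
  have P_add: "P s t + P s' t' = P (s + s') (t + t')" for s t s' t' by (simp add: vec_eq_iff forall_2)
  have cP: "continuous_on UNIV (\<lambda>s. P s 0)" "continuous_on UNIV (\<lambda>s. P 0 s)"
  proof -
    have e: "(\<lambda>s. P s 0) = (\<lambda>s. s *\<^sub>R P 1 0)" "(\<lambda>s. P 0 s) = (\<lambda>s. s *\<^sub>R P 0 1)"
      by (simp_all add: fun_eq_iff vec_eq_iff forall_2)
    show "continuous_on UNIV (\<lambda>s. P s 0)" by (subst e) (intro continuous_intros)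
    show "continuous_on UNIV (\<lambda>s. P 0 s)" by (subst e) (intro continuous_intros)
  qed
  define g0 where "g0 = g (P 0 0)"
  define A where "A s = g (P s 0) - g0" for s
  define B where "B s = g (P 0 s) - g0" for s
  have cA: "continuous_on UNIV A" and cB: "continuous_on UNIV B"
    unfolding A_def B_def by (intro continuous_intros continuous_on_compose2[OF g] cP; simp)+
  have A0: "A 0 = 0" "B 0 = 0" by (simp_all add: A_def B_def g0_def)
  have split: "g (P s t) = g0 + A s + B t" for s t
  proof -
    have "P s 0 \<bullet> P 0 t = 0" by (simp add: inner_vec_def sum_2)
    then have "g (P 0 0 + P s 0) + g (P 0 0 + P 0 t) = g (P 0 0 + P s 0 + P 0 t) + g (P 0 0)"
      using ra by (simp add: rectangle_additive_def)
    then show ?thesis by (simp add: P_add A_def B_def g0_def algebra_simps)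
  qed
  have main: "A (p + u + v) - A (p + u) - A (p + v) + A p = B (q + u) + B (q - v) - B (q - v + u) - B q" for p q u v
  proof -
    have "P u (-v) \<bullet> P v u = 0" by (simp add: inner_vec_def sum_2)
    then have "g (P p q + P u (-v)) + g (P p q + P v u) = g (P p q + P u (-v) + P v u) + g (P p q)"
      using ra by (simp add: rectangle_additive_def)
    then show ?thesis by (simp add: P_add split algebra_simps)
  qed
  have dA: "A (p + h + k) - A (p + h) - A (p + k) + A p = A (h + k) - A h - A k" for p h k
    using main[of p h k 0] main[of 0 h k 0] by (simp add: A0)
  have dB: "B (q + h + k) - B (q + h) - B (q + k) + B q = A h + A (- k) - A (h - k)" for q h k
    using main[of 0 h "- k" q] by (simp add: A0 algebra_simps)
  have dB0: "B (h + k) - B h - B k = A h + A (- k) - A (h - k)" for h k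
    using dB[of 0 h k] by (simp add: A0)
  define \<alpha> where "\<alpha> = (A 2 - 2 * A 1) / 2"
  have A: "A s = of_real s * (A 1 - \<alpha>) + of_real (s\<^sup>2) * \<alpha>" for s
    unfolding \<alpha>_def by (rule constant_second_difference_quadratic[OF cA A0(1) dA])
  have "(B 2 - 2 * B 1) / 2 = \<alpha>"
    using dB0[of 1 1] A[of "-1"] by (simp add: A0)
  moreover have "B (q + h + k) - B (q + h) - B (q + k) + B q = B (h + k) - B h - B k" for q h k
    using dB dB0 by metis
  ultimately have B: "B s = of_real s * (B 1 - \<alpha>) + of_real (s\<^sup>2) * \<alpha>" for s
    using constant_second_difference_quadratic[OF cB A0(2), of s] by simp
  have "g x = g0 + (A 1 - \<alpha>) * of_real (x $ 1) + (B 1 - \<alpha>) * of_real (x $ 2) - (- \<alpha>) * of_real ((norm x)\<^sup>2)" for x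
    using split[of "x $ 1" "x $ 2"] A[of "x $ 1"] B[of "x $ 2"] P_eq[of x]
    by (simp add: norm_square_plane algebra_simps)
  then show thesis by (rule that)
qed


section \<open>Extremizers and the orbit of the Gaussian\<close>

definition complex_gaussian :: "complex \<Rightarrow> complex \<Rightarrow> complex \<Rightarrow> real^2 \<Rightarrow> complex" where
  "complex_gaussian a b1 b2 x = exp (b1 * of_real (x $ 1) + b2 * of_real (x $ 2) - a * of_real ((norm x)\<^sup>2))"

text \<open>The factor \<open>k\<close> is left free, including \<open>k = 0\<close>, so that no constants need to be followed through
  the symmetries: in the end the prescribed norm determines \<open>cmod k\<close>.\<close>
definition gaussian_type :: "(real^2 \<Rightarrow> complex) \<Rightarrow> bool" where
  "gaussian_type f \<longleftrightarrow> (\<exists>k a b1 b2. Re a > 0 \<and> (AE x in lborel. f x = k * complex_gaussian a b1 b2 x))"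

lemma continuous_complex_gaussian [continuous_intros]: "continuous_on S (complex_gaussian a b1 b2)"
  unfolding complex_gaussian_def by (intro continuous_intros)

lemma complex_gaussian_measurable [measurable]: "complex_gaussian a b1 b2 \<in> borel_measurable borel"
  by (intro borel_measurable_continuous_onI continuous_intros)

lemma norm_complex_gaussian:
  "cmod (complex_gaussian a b1 b2 x) = exp (Re b1 * x $ 1 + Re b2 * x $ 2 - Re a * (norm x)\<^sup>2)"
  by (simp add: complex_gaussian_def)

text \<open>If \<open>Re a \<le> 0\<close>, then at each pair \<open>x\<close>, \<open>- x\<close> the squared modulus is at least \<open>1\<close> at one of the
  two points, so that the constant \<open>1\<close> would be integrable over the plane.\<close>
lemma square_integrable_complex_gaussian_decays:
  assumes int: "integrable lborel (\<lambda>x. (cmod (complex_gaussian a b1 b2 x))\<^sup>2)"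
  shows "Re a > 0"
proof (rule ccontr)
  assume neg: "\<not> Re a > 0"
  define h where "h x = (cmod (complex_gaussian a b1 b2 x))\<^sup>2" for x
  have lower: "1 \<le> h x + h (- x)" for x
  proof -
    define t where "t = Re b1 * x $ 1 + Re b2 * x $ 2"
    have q: "- Re a * (norm x)\<^sup>2 \<ge> 0" using neg by (simp add: mult_nonpos_nonneg)
    have "h x = exp (2 * (t - Re a * (norm x)\<^sup>2))" "h (- x) = exp (2 * (- t - Re a * (norm x)\<^sup>2))"
      by (simp_all add: h_def norm_complex_gaussian t_def exp_of_nat_mult[symmetric, of 2, simplified] power2_eq_square exp_add[symmetric] algebra_simps)
    moreover have "1 \<le> exp (2 * (t - Re a * (norm x)\<^sup>2)) \<or> 1 \<le> exp (2 * (- t - Re a * (norm x)\<^sup>2))"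
      using q by auto
    ultimately show ?thesis
      using zero_le_power2[of "cmod (complex_gaussian a b1 b2 x)"] zero_le_power2[of "cmod (complex_gaussian a b1 b2 (- x))"]
      unfolding h_def by linarith
  qed
  have i1: "integrable lborel h" using int by (simp add: h_def[abs_def])
  have "integrable lborel (\<lambda>x. h (0 + conformal (-1) 0 x))"
    by (rule integrable_conformal[OF _ i1]) simp
  then have i2: "integrable lborel (\<lambda>x. h (- x))" by (simp add: conformal_def)
  have "integrable lborel (\<lambda>x::real^2. 1::real)"
  proof (rule Bochner_Integration.integrable_bound[OF Bochner_Integration.integrable_add[OF i1 i2]])
    show "AE x in lborel. norm (1::real) \<le> norm (h x + h (- x))"
      using lower by (intro AE_I2) (simp add: order_trans[OF _ abs_ge_self])
  qed simp
  then have "emeasure (lborel :: (real^2) measure) UNIV < \<infinity>"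
    by (simp add: integrable_iff_bounded)
  then show False by simp
qed

theorem gaussian_type_of_equality:
  assumes f: "f \<in> L2" and nz: "L2_norm f > 0"
    and eq: "AE p in lborel. p \<in> rectangles \<longrightarrow> diagonal1 f p = diagonal2 f p"
  shows "gaussian_type f"
proof -
  obtain F where F: "continuous_on UNIV F" and fF: "AE x in lborel. f x = F x"
    using continuous_representative[OF f nz eq] .
  note [measurable] = L2_measurable[OF f] borel_measurable_continuous_onI[OF F]
  have m: "rectangle_multiplicative F"
    by (rule continuous_representative_rectangle_multiplicative[OF eq F fF])
  have "\<exists>q. F q \<noteq> 0"
  proof (rule ccontr)
    assume "\<not> ?thesis"
    then have "AE x in lborel. (cmod (f x))\<^sup>2 = 0" using fF by auto
    then have "L2_norm f = 0" by (simp add: L2_norm_def integral_eq_zero_AE)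
    then show False using nz by simp
  qed
  then have "F x \<noteq> 0" for x using rectangle_multiplicative_nonzero[OF F m] by blast
  from continuous_log_rectangle_additive[OF F m this]
  obtain g where g: "continuous_on UNIV g" "\<And>x. F x = exp (g x)" "rectangle_additive g" by blast
  obtain a b1 b2 c where gx: "\<And>x. g x = c + b1 * of_real (x $ 1) + b2 * of_real (x $ 2) - a * of_real ((norm x)\<^sup>2)"
    using rectangle_additive_quadratic[OF g(1,3)] by metis
  have Fx: "F x = exp c * complex_gaussian a b1 b2 x" for x
    by (simp add: g(2) gx complex_gaussian_def exp_add[symmetric] add_diff_eq add.assoc)
  have "integrable lborel (\<lambda>x. (cmod (f x))\<^sup>2)" using f by (simp add: L2_def)
  then have "integrable lborel (\<lambda>x. (cmod (F x))\<^sup>2)"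
    by (rule integrable_cong_AE_imp) (use fF in \<open>measurable, auto\<close>)
  then have "integrable lborel (\<lambda>x. (cmod (complex_gaussian a b1 b2 x))\<^sup>2)"
    by (simp add: Fx norm_mult power_mult_distrib)
  then have "Re a > 0" by (rule square_integrable_complex_gaussian_decays)
  with fF show ?thesis unfolding gaussian_type_def Fx by blast
qed

text \<open>A Gaussian satisfies the functional equation exactly: on a rectangle the sums of the linear terms
  over the two diagonals agree, and so do the sums of the squared distances from the origin.\<close>
lemma gaussian_type_extremal:
  assumes f: "f \<in> L2" and g: "gaussian_type f"
  shows "Re (hamiltonian f) = pi / 8 * L2_norm f ^ 4"
  unfolding hamiltonian_eq_iff[OF f]
proof -
  note [measurable] = L2_measurable[OF f]
  obtain k a b1 b2 where fF: "AE x in lborel. f x = k * complex_gaussian a b1 b2 x"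
    using g unfolding gaussian_type_def by blast
  define F where "F x = k * complex_gaussian a b1 b2 x" for x
  have fF: "AE x in lborel. f x = F x" using fF by (simp add: F_def)
  have F: "F (\<xi> + z) * F (\<xi> + l *\<^sub>R perp z) = F (\<xi> + z + l *\<^sub>R perp z) * F \<xi>" for \<xi> z l
  proof -
    have n: "(norm (\<xi> + z))\<^sup>2 + (norm (\<xi> + l *\<^sub>R perp z))\<^sup>2 = (norm (\<xi> + z + l *\<^sub>R perp z))\<^sup>2 + (norm \<xi>)\<^sup>2"
      unfolding norm_square_plane by (simp add: power2_eq_square algebra_simps)
    have "complex_gaussian a b1 b2 (\<xi> + z) * complex_gaussian a b1 b2 (\<xi> + l *\<^sub>R perp z) =
      exp (b1 * of_real ((\<xi> + z) $ 1 + (\<xi> + l *\<^sub>R perp z) $ 1) + b2 * of_real ((\<xi> + z) $ 2 + (\<xi> + l *\<^sub>R perp z) $ 2)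
         - a * of_real ((norm (\<xi> + z))\<^sup>2 + (norm (\<xi> + l *\<^sub>R perp z))\<^sup>2))"
      by (simp add: complex_gaussian_def exp_add[symmetric] algebra_simps)
    also have "\<dots> = complex_gaussian a b1 b2 (\<xi> + z + l *\<^sub>R perp z) * complex_gaussian a b1 b2 \<xi>"
      unfolding n by (simp add: complex_gaussian_def exp_add[symmetric] algebra_simps)
    finally show ?thesis by (simp add: F_def mult_ac)
  qed
  have [measurable]: "diagonal1 f \<in> borel_measurable (lborel \<Otimes>\<^sub>M lborel)" "diagonal2 f \<in> borel_measurable (lborel \<Otimes>\<^sub>M lborel)"
    by (simp_all add: lborel_prod)
  have [measurable]: "(\<lambda>q. diagonal1 f (l, q)) \<in> borel_measurable (lborel \<Otimes>\<^sub>M lborel)" "(\<lambda>q. diagonal2 f (l, q)) \<in> borel_measurable (lborel \<Otimes>\<^sub>M lborel)" for l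
    unfolding diagonal1_def diagonal2_def split_beta fst_conv snd_conv by measurable
  have "AE p in (lborel \<Otimes>\<^sub>M lborel). diagonal1 f p = diagonal2 f p"
  proof (rule lborel_pair.AE_pair_measure)
    show "{p \<in> space (lborel \<Otimes>\<^sub>M lborel). diagonal1 f p = diagonal2 f p} \<in> sets (lborel \<Otimes>\<^sub>M lborel)"
      by measurable
    show "AE l in lborel. AE q in lborel. diagonal1 f (l, q) = diagonal2 f (l, q)"
      using AE_lborel_singleton[of 0]
    proof eventually_elim
      case (elim l)
      then have nz: "0\<^sup>2 + l\<^sup>2 \<noteq> 0" "1\<^sup>2 + l\<^sup>2 \<noteq> 0" by (auto simp: add_nonneg_eq_0_iff)
      have "AE q in (lborel \<Otimes>\<^sub>M lborel). diagonal1 f (l, q) = diagonal2 f (l, q)"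
      proof (rule lborel_pair.AE_pair_measure)
        show "{q \<in> space (lborel \<Otimes>\<^sub>M lborel). diagonal1 f (l, q) = diagonal2 f (l, q)} \<in> sets (lborel \<Otimes>\<^sub>M lborel)"
          by measurable
        show "AE \<xi> in lborel. AE z in lborel. diagonal1 f (l, \<xi>, z) = diagonal2 f (l, \<xi>, z)"
          using fF
        proof eventually_elim
          case (elim \<xi>)
          have "AE z in lborel. f (\<xi> + conformal 1 0 z) = F (\<xi> + conformal 1 0 z)"
            by (rule AE_lborel_conformal[OF _ fF]) simp
          with AE_lborel_conformal[OF nz(1) fF, of \<xi>] AE_lborel_conformal[OF nz(2) fF, of \<xi>]
          show ?case
          proof eventually_elim
            case (elim z)
            then show ?case
              using F[of \<xi> z l] \<open>f \<xi> = F \<xi>\<close> by (simp add: diagonal1_def diagonal2_def conformal_def add.assoc)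
          qed
        qed
      qed
      then show ?case unfolding lborel_prod .
    qed
  qed
  then have "AE p in lborel. diagonal1 f p = diagonal2 f p"
    unfolding lborel_prod .
  then show "AE p in lborel. p \<in> rectangles \<longrightarrow> diagonal1 f p = diagonal2 f p"
    by eventually_elim simp
qed

text \<open>The square of the Gaussian is the density of a pair of independent normal variables of
  variance \<open>1/2\<close>.\<close>
lemma nn_integral_gaussian_square: "L2sq gaussian = 1"
proof -
  have "ennreal ((cmod (gaussian x))\<^sup>2) = ennreal (\<Prod>b\<in>Basis. normal_density 0 (sqrt (1/2)) (x \<bullet> b))" for x :: "real^2"
  proof -
    have "(norm x)\<^sup>2 = (\<Sum>b\<in>Basis. (x \<bullet> b)\<^sup>2)"
      by (subst power2_norm_eq_inner, subst euclidean_inner) (simp add: power2_eq_square)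
    then have "(\<Prod>b\<in>Basis. normal_density 0 (sqrt (1/2)) (x \<bullet> b)) = (1 / sqrt pi) ^ 2 * exp (- (norm x)\<^sup>2)"
      by (simp add: normal_density_def prod_dividef exp_sum sum_negf[symmetric] power_divide)
    moreover have "(cmod (gaussian x))\<^sup>2 = (1 / sqrt pi) ^ 2 * exp (- (norm x)\<^sup>2)"
      by (simp add: gaussian_def norm_mult norm_divide power_mult_distrib power_divide exp_double[symmetric])
    ultimately show ?thesis by simp
  qed
  then have "L2sq gaussian = (\<integral>\<^sup>+x. (\<Prod>b\<in>Basis. ennreal (normal_density 0 (sqrt (1/2)) (x \<bullet> b))) \<partial>(lborel :: (real^2) measure))"
    by (simp add: L2sq_def prod_ennreal)
  also have "\<dots> = (\<Prod>b\<in>(Basis :: (real^2) set). (\<integral>\<^sup>+x. ennreal (normal_density 0 (sqrt (1/2)) x) \<partial>lborel))"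
    by (rule nn_integral_lborel_prod) auto
  also have "(\<integral>\<^sup>+x. ennreal (normal_density 0 (sqrt (1/2)) x) \<partial>lborel) = 1"
    by (subst nn_integral_eq_integral) auto
  finally show ?thesis by simp
qed

lemma L2_norm_of_L2sq:
  assumes "f \<in> borel_measurable borel" "L2sq f = ennreal (m\<^sup>2)" "m \<ge> 0"
  shows "f \<in> L2" "L2_norm f = m"
proof -
  show f: "f \<in> L2" using assms by (simp add: L2_iff_nn_integral L2sq_def)
  have "(L2_norm f)\<^sup>2 = m\<^sup>2" using L2_nn_integral[OF f] assms by (simp add: L2sq_def)
  then show "L2_norm f = m" using assms(3) by simp
qed

lemma L2sq_cmult:
  assumes [measurable]: "f \<in> borel_measurable borel"
  shows "L2sq (\<lambda>x. c * f x) = ennreal ((cmod c)\<^sup>2) * L2sq f"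
  by (simp add: L2sq_def norm_mult power_mult_distrib ennreal_mult nn_integral_cmult)

lemma L2sq_cong_norm:
  "(\<And>x. cmod (f x) = cmod (g x)) \<Longrightarrow> L2sq f = L2sq g"
  by (simp add: L2sq_def)

lemma gaussian_measurable [measurable]: "gaussian \<in> borel_measurable borel"
  unfolding gaussian_def by (intro borel_measurable_continuous_onI continuous_intros) auto

text \<open>Scaling produces the decay rate \<open>Re a\<close>, translation the real parts of \<open>b1\<close> and \<open>b2\<close>, modulation
  their imaginary parts, quadratic modulation the imaginary part of \<open>a\<close>, and a phase rotation the
  argument of \<open>k\<close>. The result \<open>h5\<close> agrees with \<open>f\<close> up to a factor \<open>\<kappa> \<ge> 0\<close>. Both have norm \<open>M\<close>,
  hence \<open>\<kappa> = 1\<close>.\<close>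
theorem gaussian_type_in_orbit:
  assumes f: "f \<in> L2" and M: "L2_norm f = M" "M > 0" and g: "gaussian_type f"
  shows "equal_up_to_symmetries f (\<lambda>x. complex_of_real M * gaussian x)"
proof -
  note [measurable] = L2_measurable[OF f]
  obtain k a b1 b2 where a: "Re a > 0" and fk: "AE x in lborel. f x = k * complex_gaussian a b1 b2 x"
    using g unfolding gaussian_type_def by blast
  define \<alpha> where "\<alpha> = Re a"
  define \<mu> where "\<mu> = sqrt (2 * \<alpha>)"
  have \<mu>: "\<mu> > 0" "\<mu>\<^sup>2 = 2 * \<alpha>" using a by (simp_all add: \<mu>_def \<alpha>_def)
  define x0 :: "real^2" where "x0 = vector [- Re b1 / (2 * \<alpha>), - Re b2 / (2 * \<alpha>)]"
  define \<xi>0 :: "real^2" where "\<xi>0 = vector [Im b1, Im b2]"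
  define \<theta> where "\<theta> = Arg k"
  define h0 where "h0 x = complex_of_real M * gaussian x" for x
  define h1 where "h1 x = complex_of_real \<mu> * h0 (\<mu> *\<^sub>R x)" for x
  define h2 where "h2 x = h1 (x + x0)" for x
  define h3 where "h3 x = cis (x \<bullet> \<xi>0) * h2 x" for x
  define h4 where "h4 x = cis (- Im a * (norm x)\<^sup>2) * h3 x" for x
  define h5 where "h5 x = cis \<theta> * h4 x" for x
  have "symmetry_step h0 h1" unfolding h1_def[abs_def] using \<mu>(1) by (rule symmetry_step.scaling)
  moreover have "symmetry_step h1 h2" unfolding h2_def[abs_def] by (rule symmetry_step.translation)
  moreover have "symmetry_step h2 h3" unfolding h3_def[abs_def] by (rule symmetry_step.modulation)
  moreover have "symmetry_step h3 h4" unfolding h4_def[abs_def] by (rule symmetry_step.quadratic_modulation)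
  moreover have "symmetry_step h4 h5" unfolding h5_def[abs_def] by (rule symmetry_step.phase_rotation)
  ultimately have steps: "symmetry_step\<^sup>*\<^sup>* h0 h5"
    by (meson rtranclp.rtrancl_refl rtranclp.rtrancl_into_rtrancl)
  have [measurable]: "h0 \<in> borel_measurable borel" unfolding h0_def[abs_def] by measurable
  have [measurable]: "h1 \<in> borel_measurable borel" unfolding h1_def[abs_def] by measurable
  have [measurable]: "h2 \<in> borel_measurable borel" unfolding h2_def[abs_def] by measurable
  have [measurable]: "h5 \<in> borel_measurable borel"
    unfolding h5_def[abs_def] h4_def[abs_def] h3_def[abs_def] cis_conv_exp by measurable
  have "L2sq h5 = L2sq h2"
    by (rule L2sq_cong_norm) (simp add: h5_def h4_def h3_def norm_mult)
  also have "\<dots> = (\<integral>\<^sup>+x. ennreal ((cmod (complex_of_real \<mu> * h0 (\<mu> *\<^sub>R x0 + conformal \<mu> 0 x)))\<^sup>2) \<partial>lborel)"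
    by (simp add: L2sq_def h2_def h1_def conformal_def scaleR_add_right add.commute)
  also have "\<dots> = ennreal (1 / (\<mu>\<^sup>2 + 0\<^sup>2)) * (\<integral>\<^sup>+x. ennreal ((cmod (complex_of_real \<mu> * h0 x))\<^sup>2) \<partial>lborel)"
    by (rule nn_integral_conformal[where g = "\<lambda>x. ennreal ((cmod (complex_of_real \<mu> * h0 x))\<^sup>2)"]) (use \<mu>(1) in auto)
  also have "(\<integral>\<^sup>+x. ennreal ((cmod (complex_of_real \<mu> * h0 x))\<^sup>2) \<partial>lborel) = ennreal (\<mu>\<^sup>2) * (ennreal (M\<^sup>2) * 1)"
    using L2sq_cmult[of h0 "of_real \<mu>"] L2sq_cmult[of gaussian "of_real M"]
    by (simp add: L2sq_def[symmetric] nn_integral_gaussian_square h0_def[abs_def])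
  also have "ennreal (1 / (\<mu>\<^sup>2 + 0\<^sup>2)) * (ennreal (\<mu>\<^sup>2) * (ennreal (M\<^sup>2) * 1)) = ennreal (M\<^sup>2)"
    using \<mu>(1) by (simp add: ennreal_mult'[symmetric])
  finally have h5_norm: "L2sq h5 = ennreal (M\<^sup>2)" .
  \<comment> \<open>The factor \<open>exp (\<alpha> * (norm x0)\<^sup>2)\<close> undoes the constant produced by completing the square.\<close>
  define \<kappa> where "\<kappa> = cmod k * exp (\<alpha> * (norm x0)\<^sup>2) * sqrt pi / (\<mu> * M)"
  have proportional: "k * complex_gaussian a b1 b2 x = of_real \<kappa> * h5 x" for x
  proof -
    have k: "k = of_real (cmod k) * cis \<theta>"
      by (metis \<theta>_def rcis_cmod_Arg rcis_def)
    have quad: "- (norm (\<mu> *\<^sub>R (x + x0)))\<^sup>2 / 2 = Re b1 * x $ 1 + Re b2 * x $ 2 - \<alpha> * (norm x)\<^sup>2 - \<alpha> * (norm x0)\<^sup>2"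
    proof -
      have "- (norm (\<mu> *\<^sub>R (x + x0)))\<^sup>2 / 2 = - \<alpha> * (norm (x + x0))\<^sup>2"
        using \<mu>(2) by (simp add: power_mult_distrib)
      also have "\<dots> = - \<alpha> * ((norm x)\<^sup>2 + (norm x0)\<^sup>2) - 2 * \<alpha> * x0 $ 1 * x $ 1 - 2 * \<alpha> * x0 $ 2 * x $ 2"
        unfolding norm_square_plane by (simp add: power2_eq_square algebra_simps)
      also have "\<dots> = Re b1 * x $ 1 + Re b2 * x $ 2 - \<alpha> * (norm x)\<^sup>2 - \<alpha> * (norm x0)\<^sup>2"
        using a by (simp add: x0_def \<alpha>_def algebra_simps)
      finally show ?thesis .
    qed
    have "h5 x = cis \<theta> * (cis (- Im a * (norm x)\<^sup>2) * cis (Im b1 * x $ 1 + Im b2 * x $ 2)) *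
        of_real (\<mu> * M / sqrt pi * exp (- (norm (\<mu> *\<^sub>R (x + x0)))\<^sup>2 / 2))"
      by (simp add: h5_def h4_def h3_def h2_def h1_def h0_def gaussian_def \<xi>0_def inner_vec_def sum_2 mult_ac)
    then have "of_real \<kappa> * h5 x = of_real (cmod k) * cis \<theta> * (cis (- Im a * (norm x)\<^sup>2) * cis (Im b1 * x $ 1 + Im b2 * x $ 2)) *
        of_real (\<kappa> / cmod k * \<mu> * M / sqrt pi * exp (- (norm (\<mu> *\<^sub>R (x + x0)))\<^sup>2 / 2))"
      by (cases "k = 0") (auto simp: \<kappa>_def)
    also have "of_real (cmod k) * cis \<theta> = k" by (rule k[symmetric])
    finally have 1: "of_real \<kappa> * h5 x = k * (cis (- Im a * (norm x)\<^sup>2) * cis (Im b1 * x $ 1 + Im b2 * x $ 2)) *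
        of_real (\<kappa> / cmod k * \<mu> * M / sqrt pi * exp (- (norm (\<mu> *\<^sub>R (x + x0)))\<^sup>2 / 2))" .
    show ?thesis
    proof (cases "k = 0")
      case True
      then show ?thesis by (simp add: \<kappa>_def)
    next
      case False
      then have "\<kappa> / cmod k * \<mu> * M / sqrt pi * exp (- (norm (\<mu> *\<^sub>R (x + x0)))\<^sup>2 / 2) =
          exp (\<alpha> * (norm x0)\<^sup>2) * exp (- (norm (\<mu> *\<^sub>R (x + x0)))\<^sup>2 / 2)"
        using \<mu>(1) M(2) by (simp add: \<kappa>_def)
      also have "\<dots> = exp (Re b1 * x $ 1 + Re b2 * x $ 2 - \<alpha> * (norm x)\<^sup>2)"
        unfolding quad by (simp add: exp_add[symmetric])
      finally have 2: "of_real \<kappa> * h5 x = k * (cis (- Im a * (norm x)\<^sup>2 + (Im b1 * x $ 1 + Im b2 * x $ 2)) *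
          of_real (exp (Re b1 * x $ 1 + Re b2 * x $ 2 - \<alpha> * (norm x)\<^sup>2)))"
        using 1 by (simp add: cis_mult mult.assoc)
      have "complex_gaussian a b1 b2 x = of_real (exp (Re b1 * x $ 1 + Re b2 * x $ 2 - \<alpha> * (norm x)\<^sup>2)) *
          cis (- Im a * (norm x)\<^sup>2 + (Im b1 * x $ 1 + Im b2 * x $ 2))"
        by (simp add: complex_gaussian_def exp_eq_polar \<alpha>_def algebra_simps)
      then show ?thesis using 2 by (simp add: mult_ac)
    qed
  qed
  have fh: "AE x in lborel. f x = of_real \<kappa> * h5 x" using fk by (simp add: proportional)
  have "ennreal (M\<^sup>2) = L2sq f" using L2_nn_integral[OF f] M by (simp add: L2sq_def)
  also have "\<dots> = L2sq (\<lambda>x. of_real \<kappa> * h5 x)"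
    unfolding L2sq_def by (intro nn_integral_cong_AE) (use fh in eventually_elim, simp)
  also have "\<dots> = ennreal (\<kappa>\<^sup>2) * ennreal (M\<^sup>2)"
    by (simp add: L2sq_cmult h5_norm)
  finally have "M\<^sup>2 = \<kappa>\<^sup>2 * M\<^sup>2" by (simp add: ennreal_mult'[symmetric])
  then have "\<kappa>\<^sup>2 = 1" using M(2) by simp
  moreover have "\<kappa> \<ge> 0" using \<mu>(1) M(2) by (simp add: \<kappa>_def)
  ultimately have "\<kappa> = 1" by (simp add: power2_eq_1_iff)
  then have "AE x in lborel. f x = h5 x" using fh by simp
  with steps show ?thesis unfolding equal_up_to_symmetries_def h0_def[abs_def] by blast
qed


section \<open>Gaussian integrals with complex parameters\<close>

lemma integrable_gaussian_1d:
  assumes a: "Re a > 0"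
  shows "integrable lborel (\<lambda>t::real. exp (b * of_real t - a * of_real (t\<^sup>2)))"
proof (rule Bochner_Integration.integrable_bound)
  define m where "m = Re b / (2 * Re a)"
  define \<sigma> where "\<sigma> = 1 / sqrt (2 * Re a)"
  define C where "C = sqrt (2 * pi * \<sigma>\<^sup>2) * exp (Re a * m\<^sup>2)"
  have \<sigma>: "\<sigma> > 0" "2 * \<sigma>\<^sup>2 = 1 / Re a" using a by (simp_all add: \<sigma>_def power_divide)
  show "integrable lborel (\<lambda>t. C * normal_density m \<sigma> t)"
    using \<sigma>(1) by (intro integrable_mult_right integrable_normal_density)
  show "(\<lambda>t::real. exp (b * of_real t - a * of_real (t\<^sup>2))) \<in> borel_measurable lborel"
    by measurable
  have "Re b * t - Re a * t\<^sup>2 = Re a * m\<^sup>2 - (t - m)\<^sup>2 * Re a" for t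
    using a by (simp add: m_def power2_eq_square field_simps)
  then have "cmod (exp (b * of_real t - a * of_real (t\<^sup>2))) = C * normal_density m \<sigma> t" for t
  proof -
    have "sqrt (2 * pi * \<sigma>\<^sup>2) > 0" using \<sigma>(1) by simp
    then have "C * normal_density m \<sigma> t = exp (Re a * m\<^sup>2) * exp (- (t - m)\<^sup>2 / (2 * \<sigma>\<^sup>2))"
    proof -
      have "S * E * (1 / S * X) = E * X" if "S > 0" for S E X :: real using that by simp
      from this[OF \<open>sqrt (2 * pi * \<sigma>\<^sup>2) > 0\<close>] show ?thesis unfolding C_def normal_density_def .
    qed
    also have "- (t - m)\<^sup>2 / (2 * \<sigma>\<^sup>2) = - ((t - m)\<^sup>2 * Re a)"
      using a by (simp add: \<sigma>(2))
    also have "exp (Re a * m\<^sup>2) * exp (- ((t - m)\<^sup>2 * Re a)) = exp (Re a * m\<^sup>2 - (t - m)\<^sup>2 * Re a)"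
      by (simp add: exp_add[symmetric])
    finally show ?thesis
      using \<open>\<And>t. Re b * t - Re a * t\<^sup>2 = Re a * m\<^sup>2 - (t - m)\<^sup>2 * Re a\<close> by simp
  qed
  then show "AE t in lborel. norm (exp (b * of_real t - a * of_real (t\<^sup>2))) \<le> norm (C * normal_density m \<sigma> t)"
    by (intro AE_I2) simp
qed

lemma integral_symmetric_limit:
  fixes f :: "real \<Rightarrow> complex"
  assumes f: "integrable lborel f"
  shows "(\<lambda>n. LINT t|lborel. indicator {- real n..real n} t *\<^sub>R f t) \<longlonglongrightarrow> (LINT t|lborel. f t)"
proof (rule integral_dominated_convergence[where w = "\<lambda>t. norm (f t)"])
  show "AE t in lborel. (\<lambda>n. indicator {- real n..real n} t *\<^sub>R f t) \<longlonglongrightarrow> f t"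
  proof (rule AE_I2)
    fix t :: real
    have "\<forall>\<^sub>F n in sequentially. real n > \<bar>t\<bar>"
      using filterlim_real_sequentially unfolding filterlim_at_top_dense by blast
    then have "\<forall>\<^sub>F n in sequentially. indicator {- real n..real n} t *\<^sub>R f t = f t"
      by eventually_elim (auto simp: indicator_def)
    then show "(\<lambda>n. indicator {- real n..real n} t *\<^sub>R f t) \<longlonglongrightarrow> f t"
      by (rule tendsto_eventually)
  qed
qed (use f in \<open>auto simp: indicator_def\<close>)

text \<open>With an entire primitive \<open>K\<close> of the integrand, the integrals over \<open>[-n, n]\<close> along the two
  parallel lines differ by increments of \<open>K\<close> along segments of length \<open>cmod w\<close> at the two ends.
  There the integrand is at most \<open>B n\<close>, which tends to zero.\<close>
lemma gaussian_contour_shift: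
  assumes a: "Re a > 0"
  shows "(LINT t|lborel. exp (- a * (of_real t + w)\<^sup>2)) = (LINT t|lborel. exp (- a * (of_real t)\<^sup>2))"
proof -
  let ?G = "\<lambda>z. exp (- a * z\<^sup>2)"
  have "?G holomorphic_on UNIV" by (intro holomorphic_intros)
  then obtain K where K: "\<And>z. (K has_field_derivative ?G z) (at z)"
    using holomorphic_convex_primitive'[of UNIV ?G] by auto
  have FTC: "(LINT t|lborel. indicator {- real n..real n} t *\<^sub>R ?G (of_real t + v)) = K (of_real (real n) + v) - K (of_real (- real n) + v)" for n v
  proof (rule integral_FTC_Icc)
    fix t
    have "((\<lambda>t. K (of_real t + v)) has_vector_derivative (1 * ?G (of_real t + v))) (at t within {- real n..real n})"
    proof (rule field_vector_diff_chain_within[where g = K, unfolded o_def])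
      show "((\<lambda>t. of_real t + v) has_vector_derivative 1) (at t within {- real n..real n})"
        by (auto intro!: derivative_eq_intros)
    qed (rule has_field_derivative_at_within[OF K])
    then show "((\<lambda>t. K (of_real t + v)) has_vector_derivative ?G (of_real t + v)) (at t within {- real n..real n})"
      by simp
  qed (auto intro!: continuous_intros)
  have int: "integrable lborel (\<lambda>t. ?G (of_real t + v))" for v
  proof -
    have "?G (of_real t + v) = exp (- a * v\<^sup>2) * exp ((- 2 * a * v) * of_real t - a * of_real (t\<^sup>2))" for t
      by (simp add: exp_add[symmetric] power2_eq_square algebra_simps)
    then show ?thesis
      using integrable_mult_right[OF integrable_gaussian_1d[OF a], of "exp (- a * v\<^sup>2)" "- 2 * a * v"] by (simp only:)
  qed
  define B where "B x = exp (- Re a * x\<^sup>2 + 2 * \<bar>x\<bar> * (cmod a * cmod w) + cmod a * (cmod w)\<^sup>2)" for x :: real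
  have end_bound: "cmod (K (of_real x + w) - K (of_real x)) \<le> B x * cmod w" for x
  proof -
    have "cmod (K (of_real x + w) - K (of_real x)) \<le> B x * cmod (of_real x + w - of_real x)"
    proof (rule field_differentiable_bound[where S = "closed_segment (of_real x) (of_real x + w)" and f' = ?G])
      fix z assume "z \<in> closed_segment (of_real x) (of_real x + w)"
      then obtain t where t: "0 \<le> t" "t \<le> 1" "z = of_real x + of_real t * w"
        by (auto simp: closed_segment_def scaleR_conv_of_real algebra_simps)
      have "- Re (a * z\<^sup>2) = - Re a * x\<^sup>2 - Re (2 * of_real x * of_real t * (a * w)) - Re (of_real (t\<^sup>2) * (a * w\<^sup>2))"
        by (simp add: t(3) power2_eq_square algebra_simps)
      also have "\<dots> \<le> - Re a * x\<^sup>2 + 2 * \<bar>x\<bar> * (cmod a * cmod w) + cmod a * (cmod w)\<^sup>2"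
      proof -
        have "- Re (2 * of_real x * of_real t * (a * w)) \<le> cmod (2 * of_real x * of_real t * (a * w))"
          using abs_Re_le_cmod[of "2 * of_real x * of_real t * (a * w)"] by linarith
        also have "\<dots> = t * (2 * \<bar>x\<bar> * (cmod a * cmod w))"
          using t by (simp add: norm_mult)
        also have "\<dots> \<le> 1 * (2 * \<bar>x\<bar> * (cmod a * cmod w))"
          using t by (intro mult_right_mono) auto
        finally have 1: "- Re (2 * of_real x * of_real t * (a * w)) \<le> 2 * \<bar>x\<bar> * (cmod a * cmod w)" unfolding mult_1 .
        have "- Re (of_real (t\<^sup>2) * (a * w\<^sup>2)) \<le> cmod (of_real (t\<^sup>2) * (a * w\<^sup>2))"
          using abs_Re_le_cmod[of "of_real (t\<^sup>2) * (a * w\<^sup>2)"] by linarith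
        also have "\<dots> = t\<^sup>2 * (cmod a * (cmod w)\<^sup>2)"
          by (simp add: norm_mult norm_power)
        also have "\<dots> \<le> 1 * (cmod a * (cmod w)\<^sup>2)"
          using t by (intro mult_right_mono) (auto simp: power_le_one)
        finally have 2: "- Re (of_real (t\<^sup>2) * (a * w\<^sup>2)) \<le> cmod a * (cmod w)\<^sup>2" unfolding mult_1 .
        show ?thesis using 1 2 by linarith
      qed
      finally show "norm (?G z) \<le> B x" by (simp add: B_def)
    qed (intro convex_closed_segment has_field_derivative_at_within[OF K] ends_in_segment)+
    then show ?thesis by simp
  qed
  have B_lim: "(\<lambda>n. B (real n)) \<longlonglongrightarrow> 0"
    unfolding B_def abs_of_nat using a by real_asymp
  have B_even: "B (- x) = B x" for x by (simp add: B_def)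
  have "(\<lambda>n. (K (of_real (real n) + w) - K (of_real (- real n) + w)) - (K (of_real (real n)) - K (of_real (- real n)))) \<longlonglongrightarrow> 0"
  proof (rule Lim_null_comparison)
    show "\<forall>\<^sub>F n in sequentially. norm ((K (of_real (real n) + w) - K (of_real (- real n) + w)) - (K (of_real (real n)) - K (of_real (- real n)))) \<le> 2 * cmod w * B (real n)"
    proof (rule always_eventually, rule allI)
      fix n
      have "(K (of_real (real n) + w) - K (of_real (- real n) + w)) - (K (of_real (real n)) - K (of_real (- real n))) =
         (K (of_real (real n) + w) - K (of_real (real n))) - (K (of_real (- real n) + w) - K (of_real (- real n)))"
        by simp
      also have "cmod \<dots> \<le> B (real n) * cmod w + B (- real n) * cmod w"
        by (intro order_trans[OF norm_triangle_ineq4] add_mono end_bound)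
      finally show "norm ((K (of_real (real n) + w) - K (of_real (- real n) + w)) - (K (of_real (real n)) - K (of_real (- real n)))) \<le> 2 * cmod w * B (real n)"
        by (simp add: B_even)
    qed
    show "(\<lambda>n. 2 * cmod w * B (real n)) \<longlonglongrightarrow> 0"
      using tendsto_mult_right_zero[OF B_lim] .
  qed
  moreover have "(\<lambda>n. (K (of_real (real n) + w) - K (of_real (- real n) + w)) - (K (of_real (real n)) - K (of_real (- real n)))) \<longlonglongrightarrow>
     (LINT t|lborel. ?G (of_real t + w)) - (LINT t|lborel. ?G (of_real t))"
    using tendsto_diff[OF integral_symmetric_limit[OF int[of w]] integral_symmetric_limit[OF int[of 0]]]
    unfolding FTC by (simp add: FTC)
  ultimately have "(LINT t|lborel. ?G (of_real t + w)) - (LINT t|lborel. ?G (of_real t)) = 0"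
    using LIMSEQ_unique by blast
  then show ?thesis by simp
qed

text \<open>Complete the square. The remaining integral is left unevaluated, since only the dependence on
  \<open>b\<close> matters for the shape of a Fourier transform.\<close>
lemma gaussian_integral_1d:
  assumes a: "Re a > 0"
  shows "(LINT t|lborel. exp (b * of_real t - a * of_real (t\<^sup>2))) =
    (LINT t|lborel. exp (- a * (of_real t)\<^sup>2)) * exp (b\<^sup>2 / (4 * a))"
proof -
  have a0: "a \<noteq> 0" using a by auto
  have "exp (b * of_real t - a * of_real (t\<^sup>2)) = exp (- a * (of_real t + (- b / (2 * a)))\<^sup>2) * exp (b\<^sup>2 / (4 * a))" for t
  proof -
    define c where "c = b / (2 * a)"
    have b: "b = 2 * a * c" "- b / (2 * a) = - c" "b\<^sup>2 / (4 * a) = a * c\<^sup>2"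
      using a0 by (simp_all add: c_def power2_eq_square)
    show ?thesis
      unfolding b(2,3) exp_add[symmetric] by (rule arg_cong[where f = exp]) (simp add: b(1) power2_eq_square algebra_simps)
  qed
  then have "(LINT t|lborel. exp (b * of_real t - a * of_real (t\<^sup>2))) = (LINT t|lborel. exp (- a * (of_real t + (- b / (2 * a)))\<^sup>2)) * exp (b\<^sup>2 / (4 * a))"
    by (simp only: integral_mult_left_zero)
  then show ?thesis unfolding gaussian_contour_shift[OF a] .
qed

lemma plane_product_integral:
  fixes u v :: "real \<Rightarrow> complex"
  assumes "integrable lborel u" "integrable lborel v"
  shows "has_bochner_integral lborel (\<lambda>x::real^2. u (x $ 1) * v (x $ 2)) ((LINT t|lborel. u t) * (LINT t|lborel. v t))"
proof -
  define f where "f b = (if b = axis 1 1 then u else v)" for b :: "real^2"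
  interpret product_sigma_finite "\<lambda>_ :: real^2. lborel :: real measure" ..
  have Basis: "(Basis :: (real^2) set) = {axis 1 1, axis 2 1}"
    by (auto simp: Basis_vec_def UNIV_2)
  have ne: "axis 1 1 \<noteq> (axis 2 1 :: real^2)" by (simp add: axis_eq_axis)
  have f: "integrable lborel (f b)" for b using assms by (simp add: f_def)
  have [measurable]: "u \<in> borel_measurable borel" "v \<in> borel_measurable borel" using assms by auto
  have m: "(\<lambda>x::real^2. u (x $ 1) * v (x $ 2)) \<in> borel_measurable borel" by measurable
  have eq: "u ((\<Sum>b\<in>(Basis :: (real^2) set). p b *\<^sub>R b) $ 1) * v ((\<Sum>b\<in>(Basis :: (real^2) set). p b *\<^sub>R b) $ 2) = (\<Prod>b\<in>Basis. f b (p b))" for p :: "real^2 \<Rightarrow> real"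
    using ne by (simp add: Basis f_def axis_def)
  have "integrable (\<Pi>\<^sub>M b\<in>(Basis :: (real^2) set). lborel) (\<lambda>p. \<Prod>b\<in>Basis. f b (p b))"
    by (rule product_integrable_prod) (auto simp: f)
  moreover have "integral\<^sup>L (\<Pi>\<^sub>M b\<in>(Basis :: (real^2) set). lborel) (\<lambda>p. \<Prod>b\<in>Basis. f b (p b)) = (\<Prod>b\<in>Basis. integral\<^sup>L lborel (f b))"
    by (rule product_integral_prod) (auto simp: f)
  moreover have "(\<Prod>b\<in>Basis. integral\<^sup>L lborel (f b)) = (LINT t|lborel. u t) * (LINT t|lborel. v t)"
    using ne by (simp add: Basis f_def)
  ultimately have "has_bochner_integral (\<Pi>\<^sub>M b\<in>(Basis :: (real^2) set). lborel) (\<lambda>p. u ((\<Sum>b\<in>(Basis :: (real^2) set). p b *\<^sub>R b) $ 1) * v ((\<Sum>b\<in>(Basis :: (real^2) set). p b *\<^sub>R b) $ 2)) ((LINT t|lborel. u t) * (LINT t|lborel. v t))"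
    unfolding eq has_bochner_integral_iff by simp
  then have "has_bochner_integral (distr (\<Pi>\<^sub>M b\<in>(Basis :: (real^2) set). lborel) borel (\<lambda>p. \<Sum>b\<in>(Basis :: (real^2) set). p b *\<^sub>R b)) (\<lambda>x::real^2. u (x $ 1) * v (x $ 2)) ((LINT t|lborel. u t) * (LINT t|lborel. v t))"
    by (intro has_bochner_integral_distr m) auto
  then show ?thesis by (simp add: lborel_eq[symmetric])
qed

lemma complex_gaussian_product:
  "complex_gaussian a b1 b2 x = exp (b1 * of_real (x $ 1) - a * of_real ((x $ 1)\<^sup>2)) * exp (b2 * of_real (x $ 2) - a * of_real ((x $ 2)\<^sup>2))"
  by (simp add: complex_gaussian_def norm_square_plane exp_add[symmetric] algebra_simps)

lemma complex_gaussian_integral: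
  assumes a: "Re a > 0"
  shows "integrable lborel (complex_gaussian a b1 b2)"
    and "(LINT x|lborel. complex_gaussian a b1 b2 x) =
      (LINT t|lborel. exp (- a * (of_real t)\<^sup>2))\<^sup>2 * exp ((b1\<^sup>2 + b2\<^sup>2) / (4 * a))"
proof -
  have "has_bochner_integral lborel (complex_gaussian a b1 b2)
      ((LINT t|lborel. exp (- a * (of_real t)\<^sup>2))\<^sup>2 * exp ((b1\<^sup>2 + b2\<^sup>2) / (4 * a)))"
    using plane_product_integral[OF integrable_gaussian_1d[OF a, of b1] integrable_gaussian_1d[OF a, of b2]]
    unfolding gaussian_integral_1d[OF a] complex_gaussian_product[symmetric]
    by (simp add: power2_eq_square add_divide_distrib exp_add mult_ac)
  then show "integrable lborel (complex_gaussian a b1 b2)"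
    "(LINT x|lborel. complex_gaussian a b1 b2 x) =
      (LINT t|lborel. exp (- a * (of_real t)\<^sup>2))\<^sup>2 * exp ((b1\<^sup>2 + b2\<^sup>2) / (4 * a))"
    by (simp_all add: has_bochner_integral_iff)
qed


section \<open>The symmetries preserve Gaussians\<close>

lemma gaussian_type_mult:
  assumes "gaussian_type f" and a': "Re a' = 0"
  shows "gaussian_type (\<lambda>x. k' * complex_gaussian a' c1 c2 x * f x)"
proof -
  obtain k a b1 b2 where a: "Re a > 0" and f: "AE x in lborel. f x = k * complex_gaussian a b1 b2 x"
    using assms unfolding gaussian_type_def by blast
  have mult: "complex_gaussian a' c1 c2 x * complex_gaussian a b1 b2 x = complex_gaussian (a' + a) (c1 + b1) (c2 + b2) x" for x
    by (simp add: complex_gaussian_def exp_add[symmetric] algebra_simps)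
  have "AE x in lborel. k' * complex_gaussian a' c1 c2 x * f x = (k' * k) * complex_gaussian (a' + a) (c1 + b1) (c2 + b2) x"
    using f by eventually_elim (simp add: mult[symmetric])
  moreover have "Re (a' + a) > 0" using a a' by simp
  ultimately show ?thesis unfolding gaussian_type_def by blast
qed

text \<open>Under a conformal change of variables \<open>(norm x)\<^sup>2\<close> is multiplied by \<open>c\<^sup>2 + d\<^sup>2\<close>, up to terms of
  degree at most one, so that the shape of the exponent is kept.\<close>
lemma gaussian_type_conformal:
  assumes "gaussian_type f" and nz: "c\<^sup>2 + d\<^sup>2 \<noteq> 0"
  shows "gaussian_type (\<lambda>x. k' * f (x0 + conformal c d x))"
proof -
  obtain k a b1 b2 where a: "Re a > 0" and f: "AE x in lborel. f x = k * complex_gaussian a b1 b2 x"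
    using assms unfolding gaussian_type_def by blast
  define a' where "a' = a * of_real (c\<^sup>2 + d\<^sup>2)"
  define b1' where "b1' = b1 * of_real c + b2 * of_real d - 2 * a * of_real (x0 $ 1 * c + x0 $ 2 * d)"
  define b2' where "b2' = b2 * of_real c - b1 * of_real d - 2 * a * of_real (x0 $ 2 * c - x0 $ 1 * d)"
  have "complex_gaussian a b1 b2 (x0 + conformal c d x) = complex_gaussian a b1 b2 x0 * complex_gaussian a' b1' b2' x" for x
    unfolding complex_gaussian_def norm_square_plane exp_add[symmetric]
    by (rule arg_cong[where f = exp]) (simp add: a'_def b1'_def b2'_def power2_eq_square algebra_simps)
  then have "AE x in lborel. k' * f (x0 + conformal c d x) = (k' * k * complex_gaussian a b1 b2 x0) * complex_gaussian a' b1' b2' x"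
    using AE_lborel_conformal[OF nz f, of x0] by (auto elim!: eventually_mono simp: mult_ac)
  moreover have "c\<^sup>2 + d\<^sup>2 > 0" using nz by (simp add: less_le)
  then have "Re a' > 0" using a by (simp add: a'_def)
  ultimately show ?thesis unfolding gaussian_type_def by blast
qed

text \<open>By Fatou's lemma the integral of \<open>|T - g|\<^sup>2\<close> is at most the limit of the L2 distances.\<close>
lemma L2_limit_eq_pointwise_limit:
  fixes u :: "nat \<Rightarrow> real^2 \<Rightarrow> complex"
  assumes [measurable]: "\<And>n. u n \<in> borel_measurable borel" "g \<in> borel_measurable borel"
    and lim: "\<And>x. (\<lambda>n. u n x) \<longlonglongrightarrow> T x" and L2lim: "(\<lambda>n. L2sq (\<lambda>x. u n x - g x)) \<longlonglongrightarrow> 0"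
  shows "AE x in lborel. g x = T x"
proof -
  have [measurable]: "T \<in> borel_measurable borel"
    by (rule borel_measurable_LIMSEQ_metric[OF _ lim]) simp
  have "(\<lambda>n. ennreal ((cmod (u n x - g x))\<^sup>2)) \<longlonglongrightarrow> ennreal ((cmod (T x - g x))\<^sup>2)" for x
    by (intro tendsto_intros lim)
  then have "liminf (\<lambda>n. ennreal ((cmod (u n x - g x))\<^sup>2)) = ennreal ((cmod (T x - g x))\<^sup>2)" for x
    by (intro lim_imp_Liminf) auto
  then have "(\<integral>\<^sup>+x. ennreal ((cmod (T x - g x))\<^sup>2) \<partial>lborel) \<le> liminf (\<lambda>n. L2sq (\<lambda>x. u n x - g x))"
    using nn_integral_liminf[of "\<lambda>n x. ennreal ((cmod (u n x - g x))\<^sup>2)" lborel] by (simp add: L2sq_def)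
  also have "\<dots> = 0" using L2lim by (intro lim_imp_Liminf) auto
  finally have "(\<integral>\<^sup>+x. ennreal ((cmod (T x - g x))\<^sup>2) \<partial>lborel) = 0" by simp
  then have "AE x in lborel. ennreal ((cmod (T x - g x))\<^sup>2) = 0"
    by (subst (asm) nn_integral_0_iff_AE) auto
  then show ?thesis by (auto elim!: eventually_mono)
qed

lemma truncated_fourier_measurable:
  assumes [measurable]: "f \<in> borel_measurable borel"
  shows "truncated_fourier s R f \<in> borel_measurable borel"
proof -
  have [measurable]: "(\<lambda>x. indicat_real (cball (0::real^2) R) x) \<in> borel_measurable borel"
    by (intro borel_measurable_indicator) simp
  have "(\<lambda>\<xi>. LINT x|lborel. indicat_real (cball 0 R) x *\<^sub>R (cis (s * (x \<bullet> \<xi>)) * f x)) \<in> borel_measurable borel"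
    unfolding cis_conv_exp by measurable
  then show ?thesis
    unfolding truncated_fourier_def[abs_def] set_lebesgue_integral_def by measurable
qed

lemma cis_mult_complex_gaussian:
  "cis (s * (x \<bullet> \<xi>)) * complex_gaussian a b1 b2 x =
     complex_gaussian a (b1 + \<i> * of_real (s * \<xi> $ 1)) (b2 + \<i> * of_real (s * \<xi> $ 2)) x"
  unfolding complex_gaussian_def cis_conv_exp exp_add[symmetric] inner_vec_def sum_2
  by (rule arg_cong[where f = exp]) (simp add: algebra_simps)

text \<open>The truncated transforms converge in L2 to \<open>g\<close>, and pointwise to the Fourier integral of an
  integrable Gaussian. The latter is again Gaussian, with \<open>s\<^sup>2 / (4 a)\<close> in place of \<open>a\<close>; its real
  part is positive because inversion preserves the right half plane.\<close>
theorem gaussian_type_fourier: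
  assumes ft: "is_fourier_sgn s f g" and s: "s \<noteq> 0" and "gaussian_type f"
  shows "gaussian_type g"
proof -
  obtain k a b1 b2 where a: "Re a > 0" and fk: "AE x in lborel. f x = k * complex_gaussian a b1 b2 x"
    using assms unfolding gaussian_type_def by blast
  have fL2: "f \<in> L2" and gL2: "g \<in> L2"
    and lim: "((\<lambda>R. L2sq (\<lambda>\<xi>. truncated_fourier s R f \<xi> - g \<xi>)) \<longlongrightarrow> 0) at_top"
    using ft by (auto simp: is_fourier_sgn_def L2sq_def)
  note [measurable] = L2_measurable[OF fL2] L2_measurable[OF gL2] truncated_fourier_measurable
  define J where "J = (LINT t|lborel. exp (- a * (of_real t)\<^sup>2))"
  define k' where "k' = of_real (1 / (2 * pi)) * (k * (J\<^sup>2 * exp ((b1\<^sup>2 + b2\<^sup>2) / (4 * a))))"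
  define T where "T = (\<lambda>\<xi>. k' * complex_gaussian (of_real (s\<^sup>2) / (4 * a)) (\<i> * of_real s * b1 / (2 * a)) (\<i> * of_real s * b2 / (2 * a)) \<xi>)"
  have a0: "a \<noteq> 0" using a by auto
  have "(\<lambda>n. truncated_fourier s (real n) f \<xi>) \<longlonglongrightarrow> T \<xi>" for \<xi>
  proof -
    define \<Gamma> where "\<Gamma> = complex_gaussian a (b1 + \<i> * of_real (s * \<xi> $ 1)) (b2 + \<i> * of_real (s * \<xi> $ 2))"
    have [measurable]: "\<Gamma> \<in> borel_measurable borel" by (simp add: \<Gamma>_def)
    have ind [measurable]: "(\<lambda>x. indicat_real (cball (0::real^2) R) x) \<in> borel_measurable borel" for R
      by (intro borel_measurable_indicator) simp
    have int: "integrable lborel (\<lambda>x. k * \<Gamma> x)"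
      unfolding \<Gamma>_def by (intro integrable_mult_right complex_gaussian_integral(1) a)
    have trunc: "truncated_fourier s R f \<xi> = of_real (1 / (2 * pi)) * (LINT x|lborel. indicat_real (cball 0 R) x *\<^sub>R (k * \<Gamma> x))" for R
    proof -
      have "(LINT x|lborel. indicat_real (cball 0 R) x *\<^sub>R (cis (s * (x \<bullet> \<xi>)) * f x)) =
          (LINT x|lborel. indicat_real (cball 0 R) x *\<^sub>R (k * \<Gamma> x))"
      proof (rule integral_cong_AE)
        show "AE x in lborel. indicat_real (cball 0 R) x *\<^sub>R (cis (s * (x \<bullet> \<xi>)) * f x) = indicat_real (cball 0 R) x *\<^sub>R (k * \<Gamma> x)"
          using fk
        proof eventually_elim
          case (elim x)
          then have "cis (s * (x \<bullet> \<xi>)) * f x = k * (cis (s * (x \<bullet> \<xi>)) * complex_gaussian a b1 b2 x)" by simp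
          then show ?case by (simp only: cis_mult_complex_gaussian \<Gamma>_def)
        qed
      qed (unfold cis_conv_exp, measurable)
      then show ?thesis by (simp add: truncated_fourier_def set_lebesgue_integral_def)
    qed
    have "(\<lambda>n. LINT x|lborel. indicat_real (cball 0 (real n)) x *\<^sub>R (k * \<Gamma> x)) \<longlonglongrightarrow> (LINT x|lborel. k * \<Gamma> x)"
    proof (rule integral_dominated_convergence[where w = "\<lambda>x. norm (k * \<Gamma> x)"])
      show "AE x in lborel. (\<lambda>n. indicat_real (cball 0 (real n)) x *\<^sub>R (k * \<Gamma> x)) \<longlonglongrightarrow> k * \<Gamma> x"
      proof (rule AE_I2)
        fix x :: "real^2"
        have "\<forall>\<^sub>F n in sequentially. real n > norm x"
          using filterlim_real_sequentially unfolding filterlim_at_top_dense by blast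
        then have "\<forall>\<^sub>F n in sequentially. indicat_real (cball 0 (real n)) x *\<^sub>R (k * \<Gamma> x) = k * \<Gamma> x"
          by eventually_elim (simp add: indicator_def)
        then show "(\<lambda>n. indicat_real (cball 0 (real n)) x *\<^sub>R (k * \<Gamma> x)) \<longlonglongrightarrow> k * \<Gamma> x"
          by (rule tendsto_eventually)
      qed
      show "AE x in lborel. norm (indicat_real (cball 0 (real n)) x *\<^sub>R (k * \<Gamma> x)) \<le> norm (k * \<Gamma> x)" for n
        by (intro AE_I2) (simp add: indicator_def)
      show "integrable lborel (\<lambda>x. norm (k * \<Gamma> x))" using int by (rule integrable_norm)
    qed measurable
    then have "(\<lambda>n. truncated_fourier s (real n) f \<xi>) \<longlonglongrightarrow> of_real (1 / (2 * pi)) * (LINT x|lborel. k * \<Gamma> x)"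
      unfolding trunc by (intro tendsto_mult tendsto_const)
    also have "of_real (1 / (2 * pi)) * (LINT x|lborel. k * \<Gamma> x) = T \<xi>"
    proof -
      have "((b1 + \<i> * of_real (s * \<xi> $ 1))\<^sup>2 + (b2 + \<i> * of_real (s * \<xi> $ 2))\<^sup>2) / (4 * a) =
        (b1\<^sup>2 + b2\<^sup>2) / (4 * a) + (\<i> * of_real s * b1 / (2 * a) * of_real (\<xi> $ 1) + \<i> * of_real s * b2 / (2 * a) * of_real (\<xi> $ 2)
          - of_real (s\<^sup>2) / (4 * a) * of_real ((norm \<xi>)\<^sup>2))"
      proof -
        have sq: "(b + \<i> * of_real t)\<^sup>2 / (4 * a) = b\<^sup>2 / (4 * a) + \<i> * of_real t * b / (2 * a) - of_real (t\<^sup>2) / (4 * a)" for b t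
          using a0 by (simp add: power2_sum power_mult_distrib field_simps)
        show ?thesis
          unfolding add_divide_distrib sq norm_square_plane
          by (simp add: power_mult_distrib algebra_simps add_divide_distrib)
      qed
      then have "exp (((b1 + \<i> * of_real (s * \<xi> $ 1))\<^sup>2 + (b2 + \<i> * of_real (s * \<xi> $ 2))\<^sup>2) / (4 * a)) =
          exp ((b1\<^sup>2 + b2\<^sup>2) / (4 * a)) * complex_gaussian (of_real (s\<^sup>2) / (4 * a)) (\<i> * of_real s * b1 / (2 * a)) (\<i> * of_real s * b2 / (2 * a)) \<xi>"
        by (simp only: complex_gaussian_def exp_add)
      then have "(LINT x|lborel. \<Gamma> x) = J\<^sup>2 * (exp ((b1\<^sup>2 + b2\<^sup>2) / (4 * a)) * complex_gaussian (of_real (s\<^sup>2) / (4 * a)) (\<i> * of_real s * b1 / (2 * a)) (\<i> * of_real s * b2 / (2 * a)) \<xi>)"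
        unfolding \<Gamma>_def complex_gaussian_integral(2)[OF a] J_def[symmetric] by (simp only:)
      then show ?thesis by (simp add: T_def k'_def mult_ac)
    qed
    finally show ?thesis .
  qed
  moreover have "(\<lambda>n. L2sq (\<lambda>\<xi>. truncated_fourier s (real n) f \<xi> - g \<xi>)) \<longlonglongrightarrow> 0"
    using lim filterlim_real_sequentially by (rule filterlim_compose)
  ultimately have "AE \<xi> in lborel. g \<xi> = T \<xi>"
    by (intro L2_limit_eq_pointwise_limit[where u = "\<lambda>n. truncated_fourier s (real n) f"]) measurable
  moreover have "Re (of_real (s\<^sup>2) / (4 * a)) > 0"
  proof -
    have "of_real (s\<^sup>2) / (4 * a) = of_real (s\<^sup>2 / 4) * inverse a" using a0 by (simp add: field_simps)
    moreover have "Re (inverse a) > 0"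
      unfolding inverse_complex.sel using a by (intro divide_pos_pos add_pos_nonneg) simp_all
    ultimately have "Re (of_real (s\<^sup>2) / (4 * a)) = s\<^sup>2 / 4 * Re (inverse a)"
      by (simp only: times_complex.sel Re_complex_of_real Im_complex_of_real mult_zero_left diff_zero)
    moreover have "s\<^sup>2 / 4 > 0" using s by simp
    ultimately show ?thesis using \<open>Re (inverse a) > 0\<close> by (simp only: mult_pos_pos)
  qed
  ultimately show ?thesis unfolding gaussian_type_def T_def by blast
qed

lemma gaussian_type_symmetry_step:
  assumes "symmetry_step f g" "gaussian_type f"
  shows "gaussian_type g"
  using assms
proof cases
  case (phase_rotation \<theta>)
  then show ?thesis using gaussian_type_mult[OF assms(2), of 0 "cis \<theta>" 0 0] by (simp add: complex_gaussian_def)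
next
  case (translation x0)
  then show ?thesis using gaussian_type_conformal[OF assms(2), of 1 0 1 x0] by (simp add: conformal_def add.commute)
next
  case (modulation \<xi>0)
  have "cis (x \<bullet> \<xi>0) = complex_gaussian 0 (\<i> * of_real (\<xi>0 $ 1)) (\<i> * of_real (\<xi>0 $ 2)) x" for x
    by (simp add: complex_gaussian_def cis_conv_exp inner_vec_def sum_2 algebra_simps)
  then show ?thesis
    using gaussian_type_mult[OF assms(2), of 0 1 "\<i> * of_real (\<xi>0 $ 1)" "\<i> * of_real (\<xi>0 $ 2)"] modulation by simp
next
  case (quadratic_modulation \<tau>)
  then show ?thesis
    using gaussian_type_mult[OF assms(2), of "- \<i> * of_real \<tau>" 1 0 0] by (simp add: complex_gaussian_def cis_conv_exp mult.assoc)
next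
  case (schroedinger_group h \<tau>)
  have "gaussian_type h"
    by (rule gaussian_type_fourier[OF schroedinger_group(1) _ assms(2)]) simp
  then have "gaussian_type (\<lambda>\<xi>. 1 * complex_gaussian (\<i> * of_real \<tau>) 0 0 \<xi> * h \<xi>)"
    by (rule gaussian_type_mult) simp
  then have "gaussian_type (\<lambda>\<xi>. cis (- \<tau> * (norm \<xi>)\<^sup>2) * h \<xi>)"
    by (simp add: complex_gaussian_def cis_conv_exp mult.assoc)
  then show ?thesis
    by (rule gaussian_type_fourier[OF schroedinger_group(2) one_neq_zero])
next
  case (rotation \<theta>)
  have "rot \<theta> x = 0 + conformal (cos \<theta>) (sin \<theta>) x" for x
    by (simp add: rot_def vec_eq_iff forall_2)
  then show ?thesis using gaussian_type_conformal[OF assms(2), of "cos \<theta>" "sin \<theta>" 1 0] rotation by simp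
next
  case (scaling \<mu>)
  then show ?thesis using gaussian_type_conformal[OF assms(2), of \<mu> 0 "of_real \<mu>" 0] by (simp add: conformal_def)
next
  case fourier_transform
  then show ?thesis using gaussian_type_fourier[OF _ _ assms(2)] by simp
qed

lemma gaussian_type_gaussian: "gaussian_type (\<lambda>x. c * gaussian x)"
proof -
  have "c * gaussian x = (c / of_real (sqrt pi)) * complex_gaussian (1 / 2) 0 0 x" for x
    by (simp add: gaussian_def complex_gaussian_def exp_of_real[symmetric])
  then show ?thesis
    unfolding gaussian_type_def by (intro exI[of _ "c / of_real (sqrt pi)"] exI[of _ "1 / 2"] exI[of _ 0]) simp
qed

lemma gaussian_type_of_orbit:
  assumes "equal_up_to_symmetries f (\<lambda>x. c * gaussian x)"
  shows "gaussian_type f"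
proof -
  obtain h where steps: "symmetry_step\<^sup>*\<^sup>* (\<lambda>x. c * gaussian x) h" and fh: "AE x in lborel. f x = h x"
    using assms unfolding equal_up_to_symmetries_def by blast
  have "gaussian_type h"
    using steps by induction (auto intro: gaussian_type_gaussian gaussian_type_symmetry_step)
  then obtain k a b1 b2 where a: "Re a > 0" and h: "AE x in lborel. h x = k * complex_gaussian a b1 b2 x"
    unfolding gaussian_type_def by blast
  from fh h have "AE x in lborel. f x = k * complex_gaussian a b1 b2 x" by eventually_elim simp
  with a show ?thesis unfolding gaussian_type_def by blast
qed


section \<open>The sharp inequality and its extremizers\<close>

theorem theorem2p11:
  "(\<forall>f\<in>L2. hamiltonian_converges f \<and> hamiltonian f \<in> \<real> \<and>
        Re (hamiltonian f) \<le> pi / 8 * L2_norm f ^ 4) \<and>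
   (\<forall>C::real. (\<forall>f\<in>L2. Re (hamiltonian f) \<le> C * L2_norm f ^ 4) \<longrightarrow> pi / 8 \<le> C) \<and>
   (\<forall>M::real. M > 0 \<longrightarrow> (\<forall>f\<in>L2. L2_norm f = M \<longrightarrow>
        (hamiltonian f = complex_of_real (pi / 8 * M ^ 4) \<longleftrightarrow>
         equal_up_to_symmetries f (\<lambda>x. complex_of_real M * gaussian x))))"
proof (intro conjI ballI allI impI)
  fix f assume f: "f \<in> L2"
  show "hamiltonian_converges f" "hamiltonian f \<in> \<real>" "Re (hamiltonian f) \<le> pi / 8 * L2_norm f ^ 4"
    using f by (rule hamiltonian_converges_L2 hamiltonian_real hamiltonian_le)+
next
  fix C :: real assume C: "\<forall>f\<in>L2. Re (hamiltonian f) \<le> C * L2_norm f ^ 4"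
  have G: "gaussian \<in> L2" "L2_norm gaussian = 1"
    using L2_norm_of_L2sq[of gaussian 1] nn_integral_gaussian_square by auto
  have "Re (hamiltonian gaussian) = pi / 8"
    using gaussian_type_extremal[OF G(1)] gaussian_type_gaussian[of 1] G(2) by simp
  then show "pi / 8 \<le> C" using C G by fastforce
next
  fix M :: real and f assume M: "M > 0" and f: "f \<in> L2" and norm: "L2_norm f = M"
  have "hamiltonian f = complex_of_real (pi / 8 * M ^ 4) \<longleftrightarrow> Re (hamiltonian f) = pi / 8 * L2_norm f ^ 4"
    using hamiltonian_real[OF f] norm by (auto simp: complex_is_Real_iff complex_eq_iff)
  also have "\<dots> \<longleftrightarrow> gaussian_type f"
    using gaussian_type_extremal[OF f] gaussian_type_of_equality[OF f] M norm hamiltonian_eq_iff[OF f] by blast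
  also have "\<dots> \<longleftrightarrow> equal_up_to_symmetries f (\<lambda>x. complex_of_real M * gaussian x)"
    using gaussian_type_in_orbit[OF f norm M] gaussian_type_of_orbit by blast
  finally show "hamiltonian f = complex_of_real (pi / 8 * M ^ 4) \<longleftrightarrow>
      equal_up_to_symmetries f (\<lambda>x. complex_of_real M * gaussian x)" .
qed

end
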